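(* Let $\mathbb{K}$ be a field, let $E$ be a vector space over $\mathbb{K}$ of finite dimension $n \geq 1$, let $u\in\operatorname{End}(E)$ and let $\alpha,\beta \in \mathbb{K}\setminus\{0\}$ be such that $\alpha \neq \beta$ and $\alpha\neq-\beta$. Then $u$ is an $(\alpha,\beta)$-composite (in $\operatorname{End}(E)$) if and only if all the following conditions hold: (i) The sequences $(n_k(u,0))_{k \geq 1}$ and $(n_k(u,\alpha+\beta))_{k \geq 1}$ are intertwined. (ii) The sequences $(n_k(u,\alpha))_{k \geq 1}$ and $(n_k(u,\beta))_{k \geq 1}$ are intertwined. (iii) The elementary factors of $u_{-\{0,\alpha,\beta,\alpha+\beta\}}$ are polynomials of $(X-\alpha)(X-\beta)$.
   Context: For scalars $a,b \in \mathbb{K}\setminus\{0\}$, an element $x$ of a $\mathbb{K}$-algebra $\mathcal{A}$ is an $(a,b)$-composite if there are idempotents $p,q \in \mathcal{A}$ (i.e. $p^2=p$, $q^2=q$) with $x = a p + b q$. For $u\in\operatorname{End}(E)$, $\lambda\in\mathbb{K}$ and an integer $k\geq 1$, $n_k(u,\lambda) := \dim \operatorname{Ker}(u-\lambda\,\mathrm{id}_E)^k - \dim\operatorname{Ker}(u-\lambda\,\mathrm{id}_E)^{k-1}$. Two sequences $(u_k)_{k\geq 1}$ and $(v_k)_{k\geq 1}$ are intertwined if for all $k \geq 1$: $v_{k+1} \leq u_k$ and $u_{k+1} \leq v_k$. For a subset $\Lambda\subset\mathbb{K}$, write the minimal polynomial of $u$ as $\mu_u = P Q$ with $P$ a product of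 (possibly repeated) factors $X-\lambda$, $\lambda\in\Lambda$, and $Q$ monic with no root in $\Lambda$; then $u_{-\Lambda}$ denotes the endomorphism of $\operatorname{Ker} Q(u)$ induced by $u$. The elementary factors of an endomorphism (or square matrix) are its invariant factors: the nonconstant monic polynomials $P_1 \mid P_2 \mid \dots \mid P_N$ in $\mathbb{K}[X]$ such that it is represented by (similar to) the block-diagonal matrix of the companion matrices of $P_1,\dots,P_N$ (there are none if the space is zero). A polynomial of $R$ (with $R\in\mathbb{K}[X]$) is a polynomial of the form $S(R)$ with $S\in\mathbb{K}[X]$. *)

theory Defs
  imports "HOL-Computational_Algebra.Polynomial" "Jordan_Normal_Form.Matrix"
begin

definition intertwined :: "(nat \<Rightarrow> nat) \<Rightarrow> (nat \<Rightarrow> nat) \<Rightarrow> bool" where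
  "intertwined s t \<longleftrightarrow> (\<forall>k\<ge>1. t (k + 1) \<le> s k \<and> s (k + 1) \<le> t k)"

definition polynomial_of :: "'a::field poly \<Rightarrow> 'a poly \<Rightarrow> bool" where
  "polynomial_of R P \<longleftrightarrow> (\<exists>S. P = pcompose S R)"

(* For P = X^d + c_(d-1) X^(d-1) + ... + c_0: ones on the subdiagonal and
   last column -c_0, ..., -c_(d-1). *)
definition companion_matrix :: "'a::field poly \<Rightarrow> 'a mat" where
  "companion_matrix P = mat (degree P) (degree P)
     (\<lambda>(i, j). if j + 1 = degree P then - coeff P i else if i = j + 1 then 1 else 0)"

(* The factor Q of a nonzero polynomial M = P * Q, where P is a product of
   (possibly repeated) factors X - l with l in L, and Q is monic without root in L.
   For monic M it exists and is unique. *)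
definition rootfree_part :: "'a::field set \<Rightarrow> 'a poly \<Rightarrow> 'a poly" where
  "rootfree_part L M = (THE Q. lead_coeff Q = 1 \<and> (\<forall>l\<in>L. poly Q l \<noteq> 0) \<and>
     (\<exists>ls. set ls \<subseteq> L \<and> M = (\<Prod>l\<leftarrow>ls. [:- l, 1:]) * Q))"

(* The space is the whole type 'e with the scalar multiplication sc. *)

definition composite ::
    "('a::field \<Rightarrow> 'e::ab_group_add \<Rightarrow> 'e) \<Rightarrow> 'a \<Rightarrow> 'a \<Rightarrow> ('e \<Rightarrow> 'e) \<Rightarrow> bool" where
  "composite sc a b x \<longleftrightarrow>
     (\<exists>p q. Vector_Spaces.linear sc sc p \<and> Vector_Spaces.linear sc sc q \<and>
        p \<circ> p = p \<and> q \<circ> q = q \<and> x = (\<lambda>v. sc a (p v) + sc b (q v)))"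

definition shifted_endo ::
    "('a::field \<Rightarrow> 'e::ab_group_add \<Rightarrow> 'e) \<Rightarrow> ('e \<Rightarrow> 'e) \<Rightarrow> 'a \<Rightarrow> 'e \<Rightarrow> 'e" where
  "shifted_endo sc u l = (\<lambda>x. u x - sc l x)"

(* The kernels increase with k, so in finite dimension the subtraction never truncates. *)
definition kernel_jump ::
    "('a::field \<Rightarrow> 'e::ab_group_add \<Rightarrow> 'e) \<Rightarrow> ('e \<Rightarrow> 'e) \<Rightarrow> 'a \<Rightarrow> nat \<Rightarrow> nat" where
  "kernel_jump sc u l k =
     vector_space.dim sc {x. (shifted_endo sc u l ^^ k) x = 0} -
     vector_space.dim sc {x. (shifted_endo sc u l ^^ (k - 1)) x = 0}"

definition poly_endo ::
    "('a::field \<Rightarrow> 'e::ab_group_add \<Rightarrow> 'e) \<Rightarrow> 'a poly \<Rightarrow> ('e \<Rightarrow> 'e) \<Rightarrow> 'e \<Rightarrow> 'e" where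
  "poly_endo sc p u x = (\<Sum>i\<le>degree p. sc (coeff p i) ((u ^^ i) x))"

definition minimal_polynomial ::
    "('a::field \<Rightarrow> 'e::ab_group_add \<Rightarrow> 'e) \<Rightarrow> ('e \<Rightarrow> 'e) \<Rightarrow> 'a poly" where
  "minimal_polynomial sc u = (THE m. lead_coeff m = 1 \<and>
     (\<forall>p. (\<forall>x. poly_endo sc p u x = 0) \<longleftrightarrow> m dvd p))"

(* bs is a basis of the subspace V, and A represents in bs (coordinates in columns)
   the endomorphism of V induced by v; the values of v outside V play no role. *)
definition represents_on ::
    "('a::field \<Rightarrow> 'e::ab_group_add \<Rightarrow> 'e) \<Rightarrow> 'e set \<Rightarrow> ('e \<Rightarrow> 'e) \<Rightarrow> 'e list \<Rightarrow> 'a mat \<Rightarrow> bool" where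
  "represents_on sc V v bs A \<longleftrightarrow>
     distinct bs \<and> \<not> module.dependent sc (set bs) \<and> module.span sc (set bs) = V \<and>
     A \<in> carrier_mat (length bs) (length bs) \<and>
     (\<forall>j<length bs. v (bs ! j) = (\<Sum>i<length bs. sc (A $$ (i, j)) (bs ! i)))"

(* Ps is the list of elementary factors of the endomorphism of V induced by v. *)
definition elementary_factors ::
    "('a::field \<Rightarrow> 'e::ab_group_add \<Rightarrow> 'e) \<Rightarrow> 'e set \<Rightarrow> ('e \<Rightarrow> 'e) \<Rightarrow> 'a poly list \<Rightarrow> bool" where
  "elementary_factors sc V v Ps \<longleftrightarrow>
     (\<forall>P\<in>set Ps. lead_coeff P = 1 \<and> degree P > 0) \<and> sorted_wrt (dvd) Ps \<and>
     (\<exists>bs. represents_on sc V v bs (diag_block_mat (map companion_matrix Ps)))"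

(* Ker Q(u), with Q the rootfree part of the minimal polynomial of u: the space on which u
   induces the endomorphism obtained by discarding the eigenvalues in L *)
definition reduced_space ::
    "('a::field \<Rightarrow> 'e::ab_group_add \<Rightarrow> 'e) \<Rightarrow> ('e \<Rightarrow> 'e) \<Rightarrow> 'a set \<Rightarrow> 'e set" where
  "reduced_space sc u L =
     {x. poly_endo sc (rootfree_part L (minimal_polynomial sc u)) u x = 0}"

end

theory Submission
  imports Defs "HOL-Computational_Algebra.Polynomial_Factorial"
begin

text \<open>
  Write \<open>s = \<alpha> + \<beta>\<close> and \<open>D = X (X - s)\<close>, so that \<open>D + \<alpha>\<beta> = (X - \<alpha>) (X - \<beta>)\<close>; being a polynomial of
  \<open>(X - \<alpha>) (X - \<beta>)\<close> is the same as being a polynomial of \<open>D\<close>.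

  Necessity. Let \<open>u = \<alpha> p + \<beta> q\<close> with idempotents \<open>p\<close>, \<open>q\<close>. Then \<open>D(u) = - \<alpha>\<beta> (p - q)\<^sup>2\<close>, and
  \<open>(p - q)\<^sup>2\<close> commutes with \<open>p\<close> and \<open>q\<close>. On eigenvectors of \<open>u\<close> for \<open>0\<close>
  and \<open>s\<close> it vanishes, on those for \<open>\<alpha>\<close> and \<open>\<beta>\<close> it is the identity.
  The commutator \<open>g = pq - qp\<close> satisfies \<open>g u = (s - u) g\<close>,
  so it exchanges the generalized eigenspaces of \<open>0\<close> and \<open>s\<close>, and those of \<open>\<alpha>\<close> and \<open>\<beta>\<close>; moreover
  \<open>g\<^sup>2\<close> is a nonzero multiple of \<open>D(u) (D(u) + \<alpha>\<beta>)\<close>, hence equals \<open>u - c\<close> times an invertible factor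
  on the generalized eigenspace of each of these exceptional scalars \<open>c\<close>. Thus \<open>g\<close> behaves like half a step of the
  nilpotent map \<open>u - c\<close>, which forces the kernel jumps to be intertwined (\<open>kernel_jump_le\<close>).
  On the reduced space \<open>E\<close>, on the other hand, both \<open>(p - q)\<^sup>2\<close> and \<open>1 - (p - q)\<^sup>2\<close> are injective, and
  this gives \<open>E = F \<oplus> u F\<close> with \<open>F\<close> the fixed space of \<open>p\<close> in \<open>E\<close> (\<open>fixed_space_doubling\<close>). The space \<open>F\<close> is
  stable under \<open>D(u)\<close>; if \<open>D(u)\<close> on \<open>F\<close> has cyclic vectors \<open>x\<^sub>i\<close> with annihilators \<open>P\<^sub>i\<close>, then \<open>u\<close> on \<open>E\<close> has
  the same cyclic vectors with annihilators \<open>P\<^sub>i(D)\<close> (\<open>elementary_factors_exist\<close>).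

  Sufficiency. If \<open>E = A \<oplus> B\<close> with \<open>u A \<subseteq> B\<close> and \<open>(u - s) B \<subseteq> A\<close>, then \<open>u\<close> is a composite: let \<open>p\<close> be
  \<open>\<alpha>\<inverse> u\<close> on \<open>A\<close> and the identity on \<open>B\<close>, and let \<open>q\<close> be \<open>0\<close> on \<open>A\<close> and \<open>\<beta>\<inverse> (u - \<alpha>)\<close> on \<open>B\<close>. A similar
  recipe works if \<open>(u - \<alpha>) A \<subseteq> B\<close> and \<open>(u - \<beta>) B \<subseteq> A\<close>, and the two can be combined on a direct sum
  (\<open>composite_if_alternating\<close>). A cyclic space with annihilator \<open>P(D)\<close> splits in this way, with \<open>A\<close>
  spanned by the \<open>D\<^sup>j x\<close> and \<open>B\<close> by the \<open>X D\<^sup>j x\<close>; so does the sum of a Jordan block for \<open>0\<close> and one for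
  \<open>s\<close> whose sizes differ by at most one (\<open>alternating_pair\<close>). Intertwined jumps are precisely what
  allows all Jordan blocks to be paired like this (\<open>alternating_if_intertwined\<close>).

  Both directions rest on one existence theorem, \<open>cyclic_complement\<close>: a cyclic subspace whose
  annihilator kills the whole stable space has a stable complement.
\<close>

hide_const (open) Module.smult

section \<open>Dimensions of subspaces\<close>

context finite_dimensional_vector_space
begin

text \<open>
  Since \<open>f\<close> induces an injection of \<open>X / X'\<close> into \<open>Y / Y'\<close>, the images of a basis of \<open>X\<close> modulo \<open>X'\<close>
  can be added one by one to \<open>Y'\<close>, each raising the dimension. Written additively, the inequality
  can be chained and stays meaningful on \<open>nat\<close>.
\<close>
lemma dim_quotient_injection:
  assumes f: "Vector_Spaces.linear scale scale f"
    and X: "subspace X" and X': "subspace X'" "X' \<subseteq> X"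
    and Y': "subspace Y'" "Y' \<subseteq> Y"
    and into: "\<And>x. x \<in> X \<Longrightarrow> f x \<in> Y"
    and refl: "\<And>x. x \<in> X \<Longrightarrow> f x \<in> Y' \<Longrightarrow> x \<in> X'"
  shows "dim X + dim Y' \<le> dim Y + dim X'"
proof -
  interpret f: Vector_Spaces.linear scale scale f by (rule f)
  obtain B' where B': "B' \<subseteq> X'" "independent B'" "X' \<subseteq> span B'" "card B' = dim X'"
    using basis_exists[of X'] by metis
  obtain B where B: "B' \<subseteq> B" "B \<subseteq> X" "independent B" "X \<subseteq> span B"
    using maximal_independent_subset_extend[of B' X] B' X' by (metis order_trans)
  have finB: "finite B" using B(3) finiteI_independent by blast
  have cardB: "card B = dim X" by (rule basis_card_eq_dim[OF B(2) B(4) B(3)])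
  have spanB': "span B' = X'"
    using B' X' by (meson span_subspace)
  have "dim (Y' \<union> f ` D) = dim Y' + card D" if "finite D" "D \<subseteq> B - B'" for D
    using that
  proof (induction D rule: finite_induct)
    case empty then show ?case by simp
  next
    case (insert d D)
    have "f d \<notin> span (Y' \<union> f ` D)"
    proof
      assume "f d \<in> span (Y' \<union> f ` D)"
      then obtain y w where yw: "f d = y + w" "y \<in> span Y'" "w \<in> span (f ` D)"
        by (auto simp: span_Un)
      then obtain t where t: "t \<in> span D" "w = f t" by (auto simp: f.span_image)
      have "f (d - t) = y" using yw t by (simp add: f.diff)
      moreover have "y \<in> Y'" using yw(2) Y'(1) by (metis span_eq_iff)
      moreover have dX: "d \<in> X" using insert B by auto
      moreover have "t \<in> X" using t(1) insert B X by (metis Diff_subset insert_subset span_minimal subset_iff subset_trans)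
      ultimately have "d - t \<in> X'" using refl X subspace_diff by metis
      then have "d - t \<in> span B'" by (simp add: spanB')
      then have "(d - t) + t \<in> span (B' \<union> D)"
        by (meson t(1) span_add span_mono sup_ge1 sup_ge2 subsetD)
      moreover have "B' \<union> D \<subseteq> B - {d}" using insert B by auto
      ultimately have "d \<in> span (B - {d})" using span_mono[of "B' \<union> D" "B - {d}"] by auto
      moreover have "d \<in> B" using insert by auto
      ultimately show False using B(3) dependent_def by blast
    qed
    then have "dim (insert (f d) (Y' \<union> f ` D)) = dim Y' + card D + 1"
      using insert by (simp add: dim_insert)
    then show ?case using insert by simp
  qed
  from this[of "B - B'"] finB have "dim (Y' \<union> f ` (B - B')) = dim Y' + (card B - card B')"
    using B(1) by (simp add: card_Diff_subset finite_subset)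
  moreover have "Y' \<union> f ` (B - B') \<subseteq> Y" using Y' into B by auto
  then have "dim (Y' \<union> f ` (B - B')) \<le> dim Y" by (rule dim_subset)
  moreover have "card B' \<le> card B" using B(1) finB by (rule card_mono[rotated])
  ultimately show ?thesis using cardB B' by simp
qed

lemma linear_id: "Vector_Spaces.linear scale scale (\<lambda>x. x)"
  using module_hom_ident by simp

lemma dim_span_Un_le: "dim (span (S \<union> T)) \<le> dim S + dim T"
proof -
  obtain B where B: "B \<subseteq> S" "independent B" "S \<subseteq> span B" "card B = dim S"
    using basis_exists[of S] by metis
  obtain D where D: "D \<subseteq> T" "independent D" "T \<subseteq> span D" "card D = dim T"
    using basis_exists[of T] by metis
  have "S \<union> T \<subseteq> span (B \<union> D)"
    using B(3) D(3) span_mono[of B "B \<union> D"] span_mono[of D "B \<union> D"] by blast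
  then have "dim (S \<union> T) \<le> card (B \<union> D)"
    by (rule dim_le_card) (use B D finiteI_independent in auto)
  also have "\<dots> \<le> card B + card D" by (rule card_Un_le)
  finally show ?thesis using B D by simp
qed

lemma span_Un_span: "span (span S \<union> span T) = span (S \<union> T)"
  unfolding span_Un span_span ..

lemma dim_direct_sum:
  assumes "subspace S" "subspace T" "S \<inter> T \<subseteq> {0}"
  shows "dim (span (S \<union> T)) = dim S + dim T"
proof (rule antisym)
  show "dim (span (S \<union> T)) \<le> dim S + dim T" by (rule dim_span_Un_le)
  have "dim T + dim S \<le> dim (span (S \<union> T)) + dim {0}"
    by (rule dim_quotient_injection[OF linear_id])
      (use assms span_superset[of "S \<union> T"] in \<open>simp_all add: subspace_0, blast+\<close>)
  then show "dim S + dim T \<le> dim (span (S \<union> T))" by simp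
qed

lemma dim_linear_image_inj:
  assumes f: "Vector_Spaces.linear scale scale f" and "subspace S"
    and "\<And>x. x \<in> S \<Longrightarrow> f x = 0 \<Longrightarrow> x = 0"
  shows "dim (f ` S) = dim S"
proof (rule antisym)
  interpret f: Vector_Spaces.linear scale scale f by (rule f)
  obtain B where B: "B \<subseteq> S" "independent B" "S \<subseteq> span B" "card B = dim S"
    using basis_exists[of S] by metis
  have "dim (f ` S) \<le> card (f ` B)"
    by (rule dim_le_card) (use B f.spans_image finiteI_independent in auto)
  also have "\<dots> \<le> dim S" using B finiteI_independent card_image_le by metis
  finally show "dim (f ` S) \<le> dim S" .
  have "dim S + dim {0} \<le> dim (f ` S) + dim {0}"
    by (rule dim_quotient_injection[OF f])
      (use assms f.subspace_image[OF assms(2)] in \<open>simp_all add: subspace_0\<close>)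
  then show "dim S \<le> dim (f ` S)" by simp
qed

text \<open>
  The hyperplane is a substitute for a linear functional that vanishes on \<open>S\<close> but not at \<open>b\<close>.
\<close>
lemma hyperplane_avoiding:
  assumes "subspace S" "b \<notin> S"
  obtains H where "subspace H" "S \<subseteq> H" "b \<notin> H" "dim UNIV \<le> dim H + 1"
proof -
  obtain B where B: "B \<subseteq> S" "independent B" "S \<subseteq> span B"
    using basis_exists[of S] by metis
  have spanB: "span B = S" using B assms by (meson span_subspace)
  then have ind: "independent (insert b B)" using assms B by (simp add: independent_insertI)
  obtain D where D: "insert b B \<subseteq> D" "independent D" "UNIV \<subseteq> span D"
    using maximal_independent_subset_extend[OF _ ind, of UNIV] by auto
  have finD: "finite D" using D finiteI_independent by blast
  show ?thesis
  proof
    show "subspace (span (D - {b}))" by simp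
    have "B \<subseteq> D - {b}" using D(1) assms(2) B(1) by auto
    then show "S \<subseteq> span (D - {b})" using spanB span_mono by blast
    show "b \<notin> span (D - {b})" using D dependent_def by blast
    have "dim UNIV = card D" using basis_card_eq_dim[OF _ D(3,2)] by simp
    moreover have "dim (span (D - {b})) = card (D - {b})"
      using dim_span_eq_card_independent[OF independent_mono[OF D(2)], of "D - {b}"] by simp
    ultimately show "dim UNIV \<le> dim (span (D - {b})) + 1"
      using finD D(1) by (simp add: card_Diff_singleton)
  qed
qed

end

section \<open>Comaximal polynomials over a field\<close>

text \<open>
  Coprimality in the form in which it acts on kernels: the Bezout identity, applied to a vector.
\<close>
definition comaximal :: "'a::field poly \<Rightarrow> 'a poly \<Rightarrow> bool" where
  "comaximal p q \<longleftrightarrow> (\<exists>a b. a * p + b * q = 1)"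

text \<open>
  An element of least degree divides every element, because the remainder lies in the ideal too.
\<close>
lemma poly_ideal_generator:
  fixes I :: "'a::field poly set"
  assumes "p0 \<in> I" "p0 \<noteq> 0"
    and add: "\<And>p q. p \<in> I \<Longrightarrow> q \<in> I \<Longrightarrow> p + q \<in> I"
    and mult: "\<And>p q. q \<in> I \<Longrightarrow> p * q \<in> I"
  obtains m where "lead_coeff m = 1" "\<And>p. p \<in> I \<longleftrightarrow> m dvd p"
proof -
  obtain d where d: "d \<in> I" "d \<noteq> 0" and min: "\<And>q. q \<in> I \<Longrightarrow> q \<noteq> 0 \<Longrightarrow> degree d \<le> degree q"
    using ex_has_least_nat[of "\<lambda>q. q \<in> I \<and> q \<noteq> 0" p0 degree] assms by metis
  have iff: "p \<in> I \<longleftrightarrow> d dvd p" for p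
  proof
    assume "p \<in> I"
    then have "p + (- (p div d)) * d \<in> I" using d add mult by blast
    moreover have "p + (- (p div d)) * d = p mod d"
      by (simp add: minus_div_mult_eq_mod)
    ultimately have "p mod d \<in> I" by simp
    then have "p mod d = 0" using min d degree_mod_less[of d p] by fastforce
    then show "d dvd p" by auto
  next
    assume "d dvd p" then show "p \<in> I" using d mult by (metis dvdE mult.commute)
  qed
  let ?c = "inverse (lead_coeff d)"
  have "lead_coeff (smult ?c d) = 1" using d by simp
  moreover have "p \<in> I \<longleftrightarrow> smult ?c d dvd p" for p
    using iff d by (simp add: smult_dvd_iff)
  ultimately show ?thesis using that by blast
qed

lemma comaximal_sym: "comaximal p q \<Longrightarrow> comaximal q p"
  unfolding comaximal_def by (metis add.commute)

lemma comaximal_1 [simp]: "comaximal 1 p" "comaximal p 1"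
  unfolding comaximal_def by (metis add.right_neutral mult_1 mult_zero_left add.left_neutral)+

lemma comaximal_mult: "comaximal p r \<Longrightarrow> comaximal q r \<Longrightarrow> comaximal (p * q) r"
proof -
  assume "comaximal p r" "comaximal q r"
  then obtain a b c d where *: "a * p + b * r = 1" "c * q + d * r = 1"
    unfolding comaximal_def by blast
  have "(a * c) * (p * q) + (a * p * d + b * c * q + b * d * r) * r
      = (a * p + b * r) * (c * q + d * r)" by (simp add: algebra_simps)
  then have "(a * c) * (p * q) + (a * p * d + b * c * q + b * d * r) * r = 1" using * by simp
  then show ?thesis unfolding comaximal_def by blast
qed

lemma comaximal_power: "comaximal p q \<Longrightarrow> comaximal (p ^ n) q"
  by (induction n) (auto intro: comaximal_mult)

lemma comaximal_prod_list: "(\<And>p. p \<in> set ps \<Longrightarrow> comaximal p q) \<Longrightarrow> comaximal (prod_list ps) q"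
  by (induction ps) (auto intro: comaximal_mult)

lemma comaximal_dvd_mult: "comaximal p q \<Longrightarrow> p dvd q * r \<Longrightarrow> p dvd r"
proof -
  assume "comaximal p q" and dvd: "p dvd q * r"
  then obtain a b where "a * p + b * q = 1" unfolding comaximal_def by blast
  then have "r = (a * p + b * q) * r" by simp
  also have "\<dots> = p * (a * r) + b * (q * r)" by (simp add: algebra_simps)
  finally show ?thesis using dvd by (metis dvd_add dvd_mult dvd_triv_left)
qed

text \<open>
  The remainder of \<open>q\<close> modulo \<open>X - c\<close> is the constant \<open>q(c)\<close>, here a unit.
\<close>
lemma comaximal_linear:
  assumes "poly q c \<noteq> 0" shows "comaximal [:- c, 1:] q"
proof -
  have "[:- c, 1:] dvd q - [:poly q c:]" by (simp add: poly_eq_0_iff_dvd[symmetric])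
  then obtain k where "q - [:poly q c:] = [:- c, 1:] * k" by (elim dvdE)
  then have q: "q = [:poly q c:] + [:- c, 1:] * k" by (simp add: algebra_simps)
  let ?i = "inverse (poly q c)"
  have "(- smult ?i k) * [:- c, 1:] + [:?i:] * q = smult ?i (q - [:- c, 1:] * k)"
    by (simp add: algebra_simps smult_diff_right smult_add_right)
  also have "q - [:- c, 1:] * k = [:poly q c:]" by (subst q) simp
  also have "smult ?i [:poly q c:] = 1" using assms by simp
  finally show ?thesis unfolding comaximal_def by blast
qed

text \<open>
  A nonconstant divisor of least degree is irreducible.
\<close>
lemma exists_irreducible_factor:
  fixes m :: "'a::field poly"
  assumes "degree m > 0"
  obtains q where "irreducible q" "q dvd m" "degree q > 0"
proof -
  obtain q where q: "q dvd m" "degree q > 0"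
      and min: "\<And>r. r dvd m \<Longrightarrow> degree r > 0 \<Longrightarrow> degree q \<le> degree r"
    using ex_has_least_nat[of "\<lambda>q. q dvd m \<and> degree q > 0" m degree] assms by auto
  have "irreducible q"
  proof (rule irreducibleI)
    show "q \<noteq> 0" using q by auto
    show "\<not> q dvd 1" using q(2) is_unit_iff_degree[of q] by fastforce
    fix a b assume ab: "q = a * b"
    then have nz: "a \<noteq> 0" "b \<noteq> 0" using q by auto
    have "degree a = 0 \<or> degree b = 0"
    proof (rule ccontr)
      assume "\<not> ?thesis"
      then have "degree q \<le> degree a" "degree b > 0" using min[of a] ab q by auto
      moreover have "degree q = degree a + degree b" using ab nz degree_mult_eq by auto
      ultimately show False by simp
    qed
    then show "a dvd 1 \<or> b dvd 1" using nz by (simp add: is_unit_iff_degree)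
  qed
  then show ?thesis using that q by blast
qed

text \<open>
  The generator of the ideal of \<open>q\<close> and \<open>r\<close> divides \<open>q\<close> but is not a multiple of it, so it is a unit.
\<close>
lemma irreducible_comaximal:
  fixes q :: "'a::field poly"
  assumes "irreducible q" "\<not> q dvd r"
  shows "comaximal q r"
proof -
  let ?I = "{a * q + b * r |a b. True}"
  have q0: "q \<noteq> 0" using assms by auto
  obtain m where "lead_coeff m = 1" and m: "\<And>p. p \<in> ?I \<longleftrightarrow> m dvd p"
  proof (rule poly_ideal_generator[of q ?I])
    show "q \<in> ?I" by (rule CollectI, rule exI[of _ 1], rule exI[of _ 0]) simp
    show "q \<noteq> 0" by (rule q0)
    fix p p' assume "p \<in> ?I" "p' \<in> ?I"
    then obtain a b a' b' where "p = a * q + b * r" "p' = a' * q + b' * r" by auto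
    then have "p + p' = (a + a') * q + (b + b') * r" by (simp add: algebra_simps)
    then show "p + p' \<in> ?I" by blast
  next
    fix p p' assume "p' \<in> ?I"
    then obtain a b where "p' = a * q + b * r" by auto
    then have "p * p' = (p * a) * q + (p * b) * r" by (simp add: algebra_simps)
    then show "p * p' \<in> ?I" by blast
  qed blast
  have "q \<in> ?I" by (rule CollectI, rule exI[of _ 1], rule exI[of _ 0]) simp
  then have mq: "m dvd q" using m by blast
  have "r \<in> ?I" by (rule CollectI, rule exI[of _ 0], rule exI[of _ 1]) simp
  then have mr: "m dvd r" using m by blast
  have "\<not> q dvd m" using mr assms(2) dvd_trans by blast
  then have "m dvd 1" using assms(1) mq irreducibleD' by blast
  then have "1 \<in> ?I" using m by blast
  then show ?thesis unfolding comaximal_def by fastforce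
qed

lemma comaximal_linear_powers: "c \<noteq> d \<Longrightarrow> comaximal ([:- c, 1:] ^ k) ([:- d, 1:] ^ l)" for c d :: "'a::field"
  by (rule comaximal_power, rule comaximal_sym, rule comaximal_power, rule comaximal_linear) simp

lemma monic_dvd_antisym:
  fixes p q :: "'a::field poly"
  assumes "lead_coeff p = 1" "lead_coeff q = 1" "p dvd q" "q dvd p"
  shows "p = q"
proof -
  obtain k where k: "q = p * k" using assms(3) by (elim dvdE)
  have nz: "p \<noteq> 0" "q \<noteq> 0" using assms by auto
  then have "degree p = degree q" using assms dvd_imp_degree_le by (metis le_antisym)
  then have "degree k = 0" using k nz by (auto simp: degree_mult_eq)
  moreover have "lead_coeff k = 1" using k assms by (simp add: lead_coeff_mult)
  ultimately have "k = 1" by (metis degree_eq_zeroE lead_coeff_pCons(2) one_pCons)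
  then show ?thesis using k by simp
qed

text \<open>
  Translation in the inner variable is an invertible substitution.
\<close>
lemma polynomial_of_shift:
  fixes P R :: "'a::field poly"
  shows "polynomial_of (R + [:c:]) P \<longleftrightarrow> polynomial_of R P"
proof -
  have "polynomial_of (R + [:c:]) P" if R: "polynomial_of R P" for R c
  proof -
    obtain S where S: "P = pcompose S R" using R by (auto simp: polynomial_of_def)
    have "R = pcompose [:- c, 1:] (R + [:c:])" by (simp add: pcompose_pCons)
    then have "P = pcompose (pcompose S [:- c, 1:]) (R + [:c:])" using S by (metis pcompose_assoc)
    then show ?thesis unfolding polynomial_of_def by blast
  qed
  moreover have "R + [:c:] + [:- c:] = R" by (simp add: add.assoc)
  ultimately show ?thesis by metis
qed

lemma monic_pcompose:
  fixes P R :: "'a::field poly"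
  assumes "lead_coeff P = 1" "lead_coeff R = 1" "degree R > 0"
  shows "lead_coeff (pcompose P R) = 1"
  using assms lead_coeff_comp[of R P] by simp

section \<open>The polynomial action of an endomorphism\<close>

locale endomorphism = finite_dimensional_vector_space scale Basis
  for scale :: "'k::field \<Rightarrow> 'e::ab_group_add \<Rightarrow> 'e" (infixr "*s" 75) and Basis :: "'e set" +
  fixes u :: "'e \<Rightarrow> 'e"
  assumes linear_u: "Vector_Spaces.linear scale scale u"
begin

abbreviation act :: "'k poly \<Rightarrow> 'e \<Rightarrow> 'e" (infixr "\<cdot>" 76) where
  "p \<cdot> x \<equiv> poly_endo scale p u x"

lemma u_add: "u (x + y) = u x + u y" and u_scale: "u (c *s x) = c *s u x"
  and u_0 [simp]: "u 0 = 0"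
proof -
  interpret Vector_Spaces.linear scale scale u by (rule linear_u)
  show "u (x + y) = u x + u y" "u (c *s x) = c *s u x" "u 0 = 0" by (simp_all add: add scale)
qed

lemma act_eq_sum:
  assumes "degree p \<le> n"
  shows "p \<cdot> x = (\<Sum>i\<le>n. coeff p i *s (u ^^ i) x)"
  unfolding poly_endo_def
  by (rule sum.mono_neutral_left) (use assms in \<open>auto simp: coeff_eq_0\<close>)

lemma act_0 [simp]: "0 \<cdot> x = 0" by (simp add: poly_endo_def)

lemma act_add: "(p + q) \<cdot> x = p \<cdot> x + q \<cdot> x"
proof -
  let ?n = "max (degree p) (degree q)"
  show ?thesis
    using degree_add_le_max[of p q]
    by (simp add: act_eq_sum[of _ ?n] scale_left_distrib sum.distrib)
qed

lemma act_pCons: "pCons a p \<cdot> x = a *s x + p \<cdot> (u x)"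
proof -
  have "pCons a p \<cdot> x = (\<Sum>i\<le>Suc (degree p). coeff (pCons a p) i *s (u ^^ i) x)"
    by (rule act_eq_sum) (rule degree_pCons_le)
  also have "\<dots> = a *s x + p \<cdot> (u x)"
    by (simp add: sum.atMost_Suc_shift poly_endo_def funpow_swap1 del: sum.atMost_Suc)
  finally show ?thesis .
qed

lemma act_1 [simp]: "1 \<cdot> x = x"
  by (simp add: one_pCons act_pCons)

lemma act_linear: "Vector_Spaces.linear scale scale (poly_endo scale p u)"
proof (induction p)
  case 0
  show ?case using vector_space_axioms by (simp add: Vector_Spaces.linear_iff)
next
  case (pCons a p)
  then show ?case
    by (simp add: Vector_Spaces.linear_iff act_pCons u_add u_scale algebra_simps)
qed

lemma act_add_right: "p \<cdot> (x + y) = p \<cdot> x + p \<cdot> y"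
  and act_scale_right: "p \<cdot> (c *s x) = c *s (p \<cdot> x)"
  and act_0_right [simp]: "p \<cdot> 0 = 0" and act_neg_right: "p \<cdot> (- x) = - (p \<cdot> x)"
proof -
  interpret Vector_Spaces.linear scale scale "poly_endo scale p u" by (rule act_linear)
  show "p \<cdot> (x + y) = p \<cdot> x + p \<cdot> y" "p \<cdot> (c *s x) = c *s (p \<cdot> x)" "p \<cdot> 0 = 0"
    "p \<cdot> (- x) = - (p \<cdot> x)"
    by (simp_all add: add scale neg)
qed

lemma act_smult: "smult c p \<cdot> x = c *s (p \<cdot> x)"
  by (induction p arbitrary: x) (simp_all add: act_pCons scale_right_distrib)

lemma act_neg: "(- p) \<cdot> x = - (p \<cdot> x)"
  using act_smult[of "- 1" p x] by simp

lemma act_diff: "(p - q) \<cdot> x = p \<cdot> x - q \<cdot> x"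
  using act_add[of p "- q" x] by (simp add: act_neg)

lemma act_u: "p \<cdot> (u x) = u (p \<cdot> x)"
  by (induction p arbitrary: x) (simp_all add: act_pCons u_add u_scale)

lemma act_mult: "(p * q) \<cdot> x = p \<cdot> q \<cdot> x"
proof (induction p arbitrary: x)
  case 0 show ?case by simp
next
  case (pCons a p)
  then show ?case by (simp add: act_pCons act_add act_smult act_u)
qed

lemma act_commute: "p \<cdot> q \<cdot> x = q \<cdot> p \<cdot> x"
  by (metis act_mult mult.commute)

lemma act_linear_factor: "[:- c, 1:] \<cdot> x = u x - c *s x"
  by (simp add: act_pCons)

lemma act_power: "p ^ k \<cdot> x = ((\<lambda>y. p \<cdot> y) ^^ k) x"
  by (induction k) (simp_all add: act_mult)

lemma act_monom: "monom 1 k \<cdot> x = (u ^^ k) x"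
  by (induction k arbitrary: x) (simp_all add: monom_Suc act_pCons one_pCons[symmetric] funpow_swap1)

lemma endomorphism_act: "endomorphism scale Basis (poly_endo scale p u)"
  by unfold_locales (simp_all add: act_add_right act_scale_right)

text \<open>
  The polynomial \<open>S(R)\<close> acts through \<open>u\<close> as \<open>S\<close> acts through \<open>R(u)\<close>; this relates cyclic spaces of
  \<open>R(u)\<close> to those of \<open>u\<close>.
\<close>
lemma act_pcompose: "pcompose S R \<cdot> x = poly_endo scale S (poly_endo scale R u) x"
proof -
  interpret R: endomorphism scale Basis "poly_endo scale R u" by (rule endomorphism_act)
  show ?thesis
    by (induction S arbitrary: x)
      (simp_all add: pcompose_pCons act_add act_mult R.act_pCons R.act_u act_pCons del: R.act_linear)
qed

lemma act_comaximal_zero: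
  assumes "comaximal p q" "p \<cdot> x = 0" "q \<cdot> x = 0" shows "x = 0"
proof -
  obtain a b where "a * p + b * q = 1" using assms comaximal_def by blast
  then have "x = (a * p + b * q) \<cdot> x" by simp
  then show ?thesis using assms by (simp add: act_add act_mult)
qed

definition stable :: "'e set \<Rightarrow> bool" where
  "stable V \<longleftrightarrow> subspace V \<and> (\<forall>x\<in>V. u x \<in> V)"

lemma stable_subspace: "stable V \<Longrightarrow> subspace V" by (simp add: stable_def)

lemma stable_act: "stable V \<Longrightarrow> x \<in> V \<Longrightarrow> p \<cdot> x \<in> V"
  by (induction p arbitrary: x)
    (auto simp: stable_def act_pCons subspace_0 subspace_add subspace_scale)

lemma subspace_act_kernel: "subspace {x. p \<cdot> x = 0}"
  by (rule subspaceI) (simp_all add: act_add_right act_scale_right)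

lemma stable_kernel: "stable {x. p \<cdot> x = 0}"
  by (simp add: stable_def act_u subspace_act_kernel)

lemma stable_Int: "stable V \<Longrightarrow> stable W \<Longrightarrow> stable (V \<inter> W)"
  by (auto simp: stable_def subspace_inter)

lemma stable_span_Un: 
  assumes "stable V" "stable W" shows "stable (span (V \<union> W))"
  unfolding stable_def span_Un using assms
  by (auto simp: stable_def u_add subspace_sums span_eq_iff[THEN iffD2]) blast

definition cyclic :: "'e \<Rightarrow> 'e set" where
  "cyclic x = range (\<lambda>p. p \<cdot> x)"

lemma cyclic_stable: "stable (cyclic x)"
  unfolding stable_def
proof
  show "subspace (cyclic x)"
    unfolding cyclic_def
  proof (rule subspaceI)
    show "0 \<in> range (\<lambda>p. p \<cdot> x)" by (metis act_0 rangeI)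
  qed (auto simp: act_add[symmetric] act_smult[symmetric])
  show "\<forall>y\<in>cyclic x. u y \<in> cyclic x"
  proof
    fix y assume "y \<in> cyclic x"
    then obtain p where "y = p \<cdot> x" unfolding cyclic_def by auto
    then have "u y = pCons 0 p \<cdot> x" by (simp add: act_pCons act_u)
    then show "u y \<in> cyclic x" unfolding cyclic_def by auto
  qed
qed

lemma cyclic_self: "x \<in> cyclic x" unfolding cyclic_def by (metis act_1 rangeI)

lemma cyclic_minimal: "stable V \<Longrightarrow> x \<in> V \<Longrightarrow> cyclic x \<subseteq> V"
  unfolding cyclic_def using stable_act by auto

text \<open>
  For \<open>k\<close> equal to the degree of the annihilator of \<open>x\<close>, the iterates \<open>x, \<dots>, u\<^sup>k\<^sup>-\<^sup>1 x\<close> are the standard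
  basis of the cyclic space of \<open>x\<close>.
\<close>
definition krylov :: "'e \<Rightarrow> nat \<Rightarrow> 'e set" where
  "krylov x k = span ((\<lambda>j. (u ^^ j) x) ` {..<k})"

lemma krylov_Suc: "krylov x (Suc k) = span (insert ((u ^^ k) x) (krylov x k))"
proof -
  have "span (insert ((u ^^ k) x) ((\<lambda>j. (u ^^ j) x) ` {..<k}))
      = span (insert ((u ^^ k) x) (span ((\<lambda>j. (u ^^ j) x) ` {..<k})))"
    using span_Un[of "{(u ^^ k) x}" "(\<lambda>j. (u ^^ j) x) ` {..<k}"]
     span_Un[of "{(u ^^ k) x}" "span ((\<lambda>j. (u ^^ j) x) ` {..<k})"] by (simp add: span_span)
  then show ?thesis unfolding krylov_def by (simp add: lessThan_Suc)
qed

lemma krylov_iff: "y \<in> krylov x k \<longleftrightarrow> (\<exists>p. (\<forall>i\<ge>k. coeff p i = 0) \<and> y = p \<cdot> x)"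
proof
  let ?K = "{y. \<exists>p. (\<forall>i\<ge>k. coeff p i = 0) \<and> y = p \<cdot> x}"
  have "subspace ?K"
  proof (rule subspaceI)
    show "0 \<in> ?K" by (intro CollectI exI[of _ 0]) simp
    fix y z assume "y \<in> ?K" "z \<in> ?K"
    then obtain p q where "\<forall>i\<ge>k. coeff p i = 0" "y = p \<cdot> x" "\<forall>i\<ge>k. coeff q i = 0" "z = q \<cdot> x"
      by auto
    then show "y + z \<in> ?K" by (intro CollectI exI[of _ "p + q"]) (simp add: act_add)
  next
    fix c y assume "y \<in> ?K"
    then obtain p where "\<forall>i\<ge>k. coeff p i = 0" "y = p \<cdot> x" by auto
    then show "c *s y \<in> ?K" by (intro CollectI exI[of _ "smult c p"]) (simp add: act_smult)
  qed
  moreover have "(\<lambda>j. (u ^^ j) x) ` {..<k} \<subseteq> ?K"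
  proof
    fix y assume "y \<in> (\<lambda>j. (u ^^ j) x) ` {..<k}"
    then obtain j where "j < k" "y = (u ^^ j) x" by auto
    then show "y \<in> ?K" by (intro CollectI exI[of _ "monom 1 j"]) (simp add: act_monom)
  qed
  ultimately have "krylov x k \<subseteq> ?K" unfolding krylov_def by (simp add: span_minimal)
  then show "y \<in> krylov x k \<Longrightarrow> \<exists>p. (\<forall>i\<ge>k. coeff p i = 0) \<and> y = p \<cdot> x" by auto
next
  assume "\<exists>p. (\<forall>i\<ge>k. coeff p i = 0) \<and> y = p \<cdot> x"
  then obtain p where p: "\<forall>i\<ge>k. coeff p i = 0" "y = p \<cdot> x" by auto
  have "y = (\<Sum>i\<le>degree p. coeff p i *s (u ^^ i) x)" using p(2) by (simp add: poly_endo_def)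
  also have "\<dots> \<in> krylov x k"
    unfolding krylov_def
  proof (rule span_sum)
    fix i
    show "coeff p i *s (u ^^ i) x \<in> span ((\<lambda>j. (u ^^ j) x) ` {..<k})"
    proof (cases "i < k")
      case True then show ?thesis by (intro span_scale span_base) auto
    next
      case False then show ?thesis using p(1) by (simp add: span_zero)
    qed
  qed
  finally show "y \<in> krylov x k" .
qed

section \<open>Minimal polynomials and cyclic decompositions\<close>

text \<open>
  For a single vector this is its annihilator, for \<open>UNIV\<close> the minimal polynomial of \<open>u\<close>. The equivalence
  says that \<open>m\<close> generates the ideal of polynomials that kill \<open>S\<close>.
\<close>
definition is_min_poly :: "'e set \<Rightarrow> 'k poly \<Rightarrow> bool" where
  "is_min_poly S m \<longleftrightarrow> lead_coeff m = 1 \<and> (\<forall>p. (\<forall>x\<in>S. p \<cdot> x = 0) \<longleftrightarrow> m dvd p)"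

lemma is_min_poly_nonzero: "is_min_poly S m \<Longrightarrow> m \<noteq> 0"
  by (auto simp: is_min_poly_def)

lemma is_min_poly_kills: "is_min_poly S m \<Longrightarrow> x \<in> S \<Longrightarrow> m \<cdot> x = 0"
  by (auto simp: is_min_poly_def)

lemma is_min_poly_unique: "is_min_poly S m \<Longrightarrow> is_min_poly S m' \<Longrightarrow> m = m'"
  unfolding is_min_poly_def by (metis dvd_refl monic_dvd_antisym)

text \<open>
  Expressing \<open>u\<^sup>k x\<close> through lower iterates would give a polynomial of degree \<open>k\<close> that kills \<open>x\<close>.
\<close>
lemma not_in_krylov:
  assumes "\<And>p. p \<cdot> x = 0 \<Longrightarrow> p \<noteq> 0 \<Longrightarrow> d \<le> degree p" and "k < d"
  shows "(u ^^ k) x \<notin> krylov x k"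
proof
  assume "(u ^^ k) x \<in> krylov x k"
  then obtain p where p: "\<forall>i\<ge>k. coeff p i = 0" "(u ^^ k) x = p \<cdot> x" by (auto simp: krylov_iff)
  let ?q = "monom 1 k - p"
  have "?q \<cdot> x = 0" using p by (simp add: act_diff act_monom)
  moreover have "coeff ?q k = 1" using p by simp
  then have "?q \<noteq> 0" by auto
  moreover have "degree ?q \<le> k" by (rule degree_le) (use p in auto)
  ultimately show False using assms by fastforce
qed

lemma dim_krylov:
  assumes "\<And>p. p \<cdot> x = 0 \<Longrightarrow> p \<noteq> 0 \<Longrightarrow> d \<le> degree p" and "k \<le> d"
  shows "dim (krylov x k) = k"
  using assms(2)
proof (induction k)
  case 0 then show ?case by (simp add: krylov_def)
next
  case (Suc k)
  have "(u ^^ k) x \<notin> span (krylov x k)"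
    using not_in_krylov[of x d k] assms(1) Suc.prems by (simp add: krylov_def span_span)
  then show ?case using Suc by (simp add: krylov_Suc dim_insert)
qed

text \<open>
  Otherwise the Krylov spaces of \<open>x\<close> would have unbounded dimension.
\<close>
lemma vector_annihilator: "\<exists>p. p \<noteq> 0 \<and> p \<cdot> x = 0"
proof (rule ccontr)
  assume "\<not> ?thesis"
  then have "dim (krylov x (Suc (dim UNIV))) = Suc (dim UNIV)"
    by (intro dim_krylov[of x "Suc (dim UNIV)"]) auto
  moreover have "dim (krylov x (Suc (dim UNIV))) \<le> dim UNIV" by (rule dim_subset) simp
  ultimately show False by simp
qed

lemma annihilator_exists: "\<exists>p. p \<noteq> 0 \<and> (\<forall>x. p \<cdot> x = 0)"
proof -
  obtain q where q: "\<And>b. q b \<noteq> 0" "\<And>b. q b \<cdot> b = 0" using vector_annihilator by metis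
  let ?p = "\<Prod>b\<in>Basis. q b"
  have "Basis \<subseteq> {x. ?p \<cdot> x = 0}"
  proof
    fix b assume "b \<in> Basis"
    then have "?p = prod q (Basis - {b}) * q b"
      using finite_Basis by (simp add: prod.remove[of Basis b] mult.commute)
    then show "b \<in> {x. ?p \<cdot> x = 0}" using q by (simp add: act_mult)
  qed
  then have "span Basis \<subseteq> {x. ?p \<cdot> x = 0}" by (rule span_minimal) (rule subspace_act_kernel)
  then have "\<forall>x. ?p \<cdot> x = 0" using span_Basis by auto
  moreover have "?p \<noteq> 0" using q(1) finite_Basis by simp
  ultimately show ?thesis by blast
qed

lemma min_poly_exists: "\<exists>m. is_min_poly S m"
proof -
  obtain p where p: "p \<noteq> 0" "\<forall>x. p \<cdot> x = 0" using annihilator_exists by blast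
  obtain m where "lead_coeff m = 1" "\<And>p. p \<in> {p. \<forall>x\<in>S. p \<cdot> x = 0} \<longleftrightarrow> m dvd p"
    by (rule poly_ideal_generator[of p "{p. \<forall>x\<in>S. p \<cdot> x = 0}"])
      (use p in \<open>auto simp: act_add act_mult\<close>)
  then show ?thesis unfolding is_min_poly_def by auto
qed

lemma minimal_polynomial_is_min_poly: "is_min_poly UNIV (minimal_polynomial scale u)"
proof -
  obtain m where m: "is_min_poly UNIV m" using min_poly_exists by blast
  have "minimal_polynomial scale u = (THE m. is_min_poly UNIV m)"
    by (simp add: minimal_polynomial_def is_min_poly_def)
  also have "\<dots> = m" using m is_min_poly_unique by (intro the_equality) auto
  finally show ?thesis using m by simp
qed

lemma min_poly_singleton: "is_min_poly {x} m \<longleftrightarrow> lead_coeff m = 1 \<and> (\<forall>p. p \<cdot> x = 0 \<longleftrightarrow> m dvd p)"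
  by (simp add: is_min_poly_def)

lemma min_poly_degree:
  assumes "is_min_poly {x} m" "p \<cdot> x = 0" "p \<noteq> 0" shows "degree m \<le> degree p"
  using assms by (simp add: min_poly_singleton dvd_imp_degree_le)

lemma krylov_mod:
  assumes "m \<cdot> x = 0" "m \<noteq> 0" shows "p \<cdot> x \<in> krylov x (degree m)"
proof -
  have "p \<cdot> x = (p mod m + p div m * m) \<cdot> x" by simp
  also have "\<dots> = (p mod m) \<cdot> x" unfolding act_add act_mult using assms by simp
  finally have "p \<cdot> x = (p mod m) \<cdot> x" .
  moreover have "\<forall>i\<ge>degree m. coeff (p mod m) i = 0"
    using degree_mod_less[OF assms(2), of p] by (auto intro: coeff_eq_0)
  ultimately show ?thesis by (auto simp: krylov_iff)
qed

lemma cyclic_eq_krylov: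
  assumes "m \<cdot> x = 0" "m \<noteq> 0" shows "cyclic x = krylov x (degree m)"
  using krylov_mod[OF assms] by (auto simp: cyclic_def krylov_iff)

lemma dim_cyclic: "is_min_poly {x} m \<Longrightarrow> dim (cyclic x) = degree m"
  using dim_krylov[of x "degree m" "degree m"] min_poly_degree cyclic_eq_krylov
    is_min_poly_nonzero is_min_poly_kills[of "{x}" m x] by simp

text \<open>
  If \<open>q\<^sup>j\<close> with \<open>j < k\<close> were the exact power of \<open>q\<close> in \<open>p\<close>, the cofactor would be comaximal to \<open>q\<^sup>k\<close>,
  whence \<open>q\<^sup>j\<close> would already kill \<open>x\<close>.
\<close>
lemma prime_power_dvd_annihilator:
  assumes q: "irreducible q" and x: "q ^ k \<cdot> x = 0" "q ^ (k - 1) \<cdot> x \<noteq> 0" and p: "p \<cdot> x = 0"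
  shows "q ^ k dvd p"
proof -
  have "q ^ j dvd p" if "j \<le> k" for j
    using that
  proof (induction j)
    case 0 then show ?case by simp
  next
    case (Suc j)
    then obtain p' where p': "p = q ^ j * p'" by (auto elim: dvdE)
    show ?case
    proof (rule ccontr)
      assume "\<not> ?case"
      then have "\<not> q dvd p'" using p' by (metis mult_dvd_mono dvd_refl power_Suc2)
      then have c: "comaximal (q ^ k) p'" using q by (intro comaximal_power irreducible_comaximal)
      have "q ^ k \<cdot> (q ^ j \<cdot> x) = 0" using x by (simp add: act_commute[of "q ^ k"])
      moreover have "p' \<cdot> (q ^ j \<cdot> x) = 0"
        using p p' by (simp add: act_mult act_commute[of p'])
      ultimately have "q ^ j \<cdot> x = 0" using act_comaximal_zero[OF c] by blast
      moreover have "q ^ (k - 1) = q ^ (k - 1 - j) * q ^ j"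
        using Suc.prems by (simp add: power_add[symmetric])
      ultimately show False using x by (simp add: act_mult)
    qed
  qed
  then show ?thesis by simp
qed

text \<open>
  The minimal polynomial of a stable space is the annihilator of one of its vectors. Write
  \<open>m = q\<^sup>k r\<close> with \<open>q\<close> irreducible and \<open>q\<close> not dividing \<open>r\<close>. By induction \<open>r\<close> is the annihilator of some
  \<open>x1\<close> in the kernel of \<open>r(u)\<close>; if \<open>y\<close> is not killed by \<open>q\<^sup>k\<^sup>-\<^sup>1 r\<close>, then \<open>x2 = r(u) y\<close> has the annihilator
  \<open>q\<^sup>k\<close>. As \<open>q\<^sup>k\<close> and \<open>r\<close> are comaximal, \<open>x1 + x2\<close> has the annihilator \<open>q\<^sup>k r\<close>.
\<close>
lemma max_vector:
  assumes "stable V" "is_min_poly V m"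
  shows "\<exists>x\<in>V. is_min_poly {x} m"
  using assms
proof (induction "degree m" arbitrary: m V rule: less_induct)
  case less
  have m: "lead_coeff m = 1" "m \<noteq> 0" and mV: "\<And>p. (\<forall>x\<in>V. p \<cdot> x = 0) \<longleftrightarrow> m dvd p"
    using less.prems(2) is_min_poly_nonzero by (auto simp: is_min_poly_def)
  show ?case
  proof (cases "degree m = 0")
    case True
    then have "m = 1" using m(1) by (metis degree_0_id of_nat_0 lead_coeff_pCons(2) one_pCons degree_eq_zeroE)
    then have "is_min_poly {0} m" by (simp add: is_min_poly_def)
    moreover have "0 \<in> V" using less.prems(1) stable_subspace subspace_0 by blast
    ultimately show ?thesis by blast
  next
    case False
    then obtain q where q: "irreducible q" "q dvd m" "degree q > 0"
      using exists_irreducible_factor[of m] by auto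
    define k where "k = Max {k. q ^ k dvd m}"
    have bound: "k \<le> degree m" if "q ^ k dvd m" for k
    proof -
      have "degree (q ^ k) \<le> degree m" using that m(2) by (rule dvd_imp_degree_le)
      moreover have "k \<le> k * degree q" using q(3) by simp
      moreover have "degree (q ^ k) = k * degree q" using q(3) by (intro degree_power_eq) auto
      ultimately show ?thesis by (metis le_trans)
    qed
    then have fin: "finite {k. q ^ k dvd m}" by (auto intro: finite_subset[of _ "{..degree m}"])
    have k: "q ^ k dvd m" using Max_in[OF fin] unfolding k_def by (metis (mono_tags) empty_iff mem_Collect_eq one_dvd power_0)
    have k': "\<not> q ^ Suc k dvd m" using Max_ge[OF fin, of "Suc k"] unfolding k_def by auto
    have k1: "k \<ge> 1" using Max_ge[OF fin, of 1] q(2) unfolding k_def by auto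
    obtain r where r: "m = q ^ k * r" using k by (elim dvdE)
    have nz: "q \<noteq> 0" "r \<noteq> 0" using r m(2) q(3) by auto
    have "\<not> q dvd r" using k' r by (metis mult.assoc mult_dvd_mono dvd_refl power_Suc2)
    then have co: "comaximal (q ^ k) r" using q(1) by (intro comaximal_power irreducible_comaximal)
    have deg: "degree r < degree m"
      using r nz q(3) k1 by (simp add: degree_mult_eq degree_power_eq)
    let ?V1 = "V \<inter> {x. r \<cdot> x = 0}"
    obtain r' where r': "is_min_poly ?V1 r'" using min_poly_exists by blast
    have iff1: "(\<forall>x\<in>?V1. p \<cdot> x = 0) \<longleftrightarrow> r dvd p" for p
    proof
      assume p: "\<forall>x\<in>?V1. p \<cdot> x = 0"
      have "\<forall>y\<in>V. (p * q ^ k) \<cdot> y = 0"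
      proof
        fix y assume y: "y \<in> V"
        have "r \<cdot> (q ^ k \<cdot> y) = m \<cdot> y" by (simp add: r act_mult[symmetric] mult.commute)
        then have "q ^ k \<cdot> y \<in> ?V1"
          using y less.prems(1) is_min_poly_kills[OF less.prems(2) y] stable_act by auto
        then show "(p * q ^ k) \<cdot> y = 0" using p by (simp add: act_mult)
      qed
      then have "q ^ k * r dvd p * q ^ k" using mV r by blast
      then show "r dvd p" using nz by (simp add: mult.commute[of "q ^ k"])
    next
      assume "r dvd p"
      then show "\<forall>x\<in>?V1. p \<cdot> x = 0" by (auto elim!: dvdE simp: act_mult act_commute[of r])
    qed
    have st1: "stable ?V1" using less.prems(1) stable_kernel stable_Int by blast
    have dvd: "r' dvd r" "r dvd r'" using iff1 r' by (auto simp: is_min_poly_def)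
    then have "degree r' \<le> degree r" using nz by (simp add: dvd_imp_degree_le)
    then obtain x1 where x1: "x1 \<in> ?V1" "is_min_poly {x1} r'"
      using less.hyps[OF _ st1 r'] deg by auto
    have x1r: "p \<cdot> x1 = 0 \<longleftrightarrow> r dvd p" for p
      using x1(2) dvd by (simp add: min_poly_singleton) (metis dvd_trans)
    have "\<not> m dvd q ^ (k - 1) * r"
    proof
      assume "m dvd q ^ (k - 1) * r"
      then have "q ^ k dvd q ^ (k - 1)" using nz r by simp
      then have "degree (q ^ k) \<le> degree (q ^ (k - 1))" using nz by (intro dvd_imp_degree_le) auto
      then show False using k1 q(3) nz by (simp add: degree_power_eq)
    qed
    then obtain y where y: "y \<in> V" "(q ^ (k - 1) * r) \<cdot> y \<noteq> 0" using mV by blast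
    define x2 where "x2 = r \<cdot> y"
    have x2V: "x2 \<in> V" using y less.prems(1) stable_act by (simp add: x2_def)
    have x2: "q ^ k \<cdot> x2 = 0" "q ^ (k - 1) \<cdot> x2 \<noteq> 0"
      using y is_min_poly_kills[OF less.prems(2) y(1)] r by (auto simp: x2_def act_mult)
    have x2q: "q ^ k dvd p" if "p \<cdot> x2 = 0" for p
      by (rule prime_power_dvd_annihilator[OF q(1) x2 that])
    have "is_min_poly {x1 + x2} m"
      unfolding min_poly_singleton
    proof (intro conjI allI iffI)
      show "lead_coeff m = 1" by (rule m(1))
      fix p
      { assume "m dvd p"
        then have "\<forall>x\<in>V. p \<cdot> x = 0" using mV by blast
        then show "p \<cdot> (x1 + x2) = 0" using x1(1) x2V by (simp add: act_add_right) }
      { assume p: "p \<cdot> (x1 + x2) = 0"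
        then have eq: "p \<cdot> x1 = - (p \<cdot> x2)" by (simp add: act_add_right eq_neg_iff_add_eq_0)
        have rx1: "r \<cdot> x1 = 0" using x1 by auto
        have "r \<cdot> (p \<cdot> x1) = 0" using rx1 by (simp add: act_commute[of r])
        moreover have "q ^ k \<cdot> (p \<cdot> x1) = 0"
          using x2(1) by (simp add: eq act_neg_right act_commute[of "q ^ k"])
        ultimately have "p \<cdot> x1 = 0" using act_comaximal_zero[OF co] by blast
        then have "r dvd p" "p \<cdot> x2 = 0" using x1r eq by auto
        then obtain s where s: "p = s * r" by (metis dvdE mult.commute)
        have "q ^ k dvd s * r" using x2q[OF \<open>p \<cdot> x2 = 0\<close>] s by simp
        then have "q ^ k dvd s" using comaximal_dvd_mult[OF co, of s] by (simp add: mult.commute)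
        then show "m dvd p" using s r by (simp add: mult_dvd_mono) }
    qed
    moreover have "x1 + x2 \<in> V"
      using x1 x2V less.prems(1) stable_subspace subspace_add by blast
    ultimately show ?thesis by blast
  qed
qed

text \<open>
  Let \<open>d\<close> be the degree of \<open>m\<close>, and let \<open>H\<close> be a hyperplane that contains \<open>x, \<dots>, u\<^sup>d\<^sup>-\<^sup>2 x\<close> but not \<open>u\<^sup>d\<^sup>-\<^sup>1 x\<close>.
  The complement is the largest stable subspace of \<open>V\<close> inside \<open>H\<close>, that is, the set of \<open>y\<close> all of whose
  iterates lie in \<open>H\<close>. Since \<open>m\<close> kills \<open>V\<close>, the first \<open>d\<close> iterates suffice, and each of these conditions
  costs at most one dimension.
\<close>
lemma cyclic_complement:
  assumes V: "stable V" and x: "x \<in> V" "is_min_poly {x} m" and kill: "\<And>y. y \<in> V \<Longrightarrow> m \<cdot> y = 0"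
  obtains W where "stable W" "W \<subseteq> V" "cyclic x \<inter> W \<subseteq> {0}" "span (cyclic x \<union> W) = V"
    "dim V = degree m + dim W"
proof -
  define d where "d = degree m"
  have m: "lead_coeff m = 1" "m \<noteq> 0" using x is_min_poly_nonzero by (auto simp: is_min_poly_def)
  have mx: "p \<cdot> x = 0 \<Longrightarrow> p \<noteq> 0 \<Longrightarrow> d \<le> degree p" for p
    using min_poly_degree[OF x(2)] d_def by simp
  have subV: "subspace V" using V stable_subspace by blast
  show ?thesis
  proof (cases "d = 0")
    case True
    then have "m = 1" using m(1) d_def by (metis degree_eq_zeroE lead_coeff_pCons(2) one_pCons)
    then have "x = 0" using x(2) is_min_poly_kills[of "{x}" m x] by simp
    then have c: "cyclic x = {0}" by (auto simp: cyclic_def)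
    have "span ({0} \<union> V) = V" using subV subspace_0[of V] by (simp add: insert_absorb)
    then show ?thesis using that[of V] V c True by (simp add: d_def)
  next
    case False
    obtain H where H: "subspace H" "krylov x (d - 1) \<subseteq> H" "(u ^^ (d - 1)) x \<notin> H"
        "dim UNIV \<le> dim H + 1"
      by (rule hyperplane_avoiding[of "krylov x (d - 1)" "(u ^^ (d - 1)) x"])
        (use not_in_krylov[where x=x and d=d and k="d - 1", OF mx] False in \<open>auto simp: krylov_def\<close>)
    define W where "W k = {y \<in> V. \<forall>j<k. (u ^^ j) y \<in> H}" for k
    have lin: "Vector_Spaces.linear scale scale (u ^^ j)" for j
      using act_linear[of "monom 1 j"] by (simp add: act_monom[abs_def])
    have subW: "subspace (W k)" for k
    proof (rule subspaceI)
      interpret j: Vector_Spaces.linear scale scale "u ^^ j" for j by (rule lin)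
      show "0 \<in> W k" using subV H(1) by (simp add: W_def subspace_0 j.zero)
      show "x + y \<in> W k" if "x \<in> W k" "y \<in> W k" for x y
        using that subV H(1) by (simp add: W_def subspace_add j.add)
      show "c *s x \<in> W k" if "x \<in> W k" for c x
        using that subV H(1) by (simp add: W_def subspace_scale j.scale)
    qed
    have codim: "dim V \<le> dim (W k) + k" for k
    proof (induction k)
      case 0 then show ?case by (simp add: W_def)
    next
      case (Suc k)
      have "dim (W k) + dim H \<le> dim UNIV + dim (W (Suc k))"
        by (rule dim_quotient_injection[OF lin[of k] subW subW]) (use H(1) in \<open>auto simp: W_def less_Suc_eq\<close>)
      then show ?case using Suc H(4) by simp
    qed
    have stW: "stable (W d)"
      unfolding stable_def
    proof (intro conjI ballI)
      show "subspace (W d)" by (rule subW)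
      fix y assume y: "y \<in> W d"
      then have yV: "y \<in> V" by (simp add: W_def)
      have "(u ^^ j) (u y) \<in> H" if "j < d" for j
      proof (cases "Suc j < d")
        case True
        then have "(u ^^ Suc j) y \<in> H" using y unfolding W_def by blast
        then show ?thesis by (simp add: funpow_swap1[symmetric])
      next
        case False
        then have j: "Suc j = d" using that by simp
        have "0 = m \<cdot> y" using kill yV by simp
        also have "\<dots> = (\<Sum>i<d. coeff m i *s (u ^^ i) y) + (u ^^ d) y"
          using m(1) unfolding poly_endo_def by (simp add: d_def lessThan_Suc_atMost[symmetric])
        finally have "(u ^^ d) y = - (\<Sum>i<d. coeff m i *s (u ^^ i) y)"
          by (metis neg_eq_iff_add_eq_0 add.commute minus_minus)
        also have "\<dots> \<in> H"
          using H(1) y by (intro subspace_neg subspace_sum subspace_scale) (auto simp: W_def)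
        finally show ?thesis using j by (metis comp_apply funpow_Suc_right)
      qed
      then show "u y \<in> W d" using yV V by (simp add: W_def stable_def)
    qed
    have int: "cyclic x \<inter> W d \<subseteq> {0}"
    proof
      fix z assume z: "z \<in> cyclic x \<inter> W d"
      then obtain p where p: "\<forall>i\<ge>d. coeff p i = 0" "z = p \<cdot> x"
        using cyclic_eq_krylov[of m x] is_min_poly_kills[OF x(2)] m krylov_iff d_def by auto
      \<comment> \<open>with \<open>t = degree p\<close>, the iterate of exponent \<open>d - 1 - t\<close> moves the leading term of \<open>z = p(u) x\<close> to \<open>u\<^sup>d\<^sup>-\<^sup>1 x\<close>\<close>
      have "p = 0"
      proof (rule ccontr)
        assume nz: "p \<noteq> 0"
        define t where "t = degree p"
        have ct: "coeff p t \<noteq> 0" using nz t_def by simp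
        have t: "t < d" using p(1) ct by (meson not_le)
        let ?e = "d - 1 - t"
        have "(u ^^ ?e) z \<in> H" using z t by (auto simp: W_def)
        moreover have "(u ^^ ?e) z = (monom 1 ?e * p) \<cdot> x" by (simp add: p act_mult act_monom)
        moreover define q where "q = monom 1 ?e * p - monom (coeff p t) (d - 1)"
        then have "monom 1 ?e * p = q + smult (coeff p t) (monom 1 (d - 1))"
          by (simp add: smult_monom)
        ultimately have inH: "q \<cdot> x + coeff p t *s (u ^^ (d - 1)) x \<in> H"
          by (simp add: act_add act_smult act_monom)
        have "coeff q i = 0" if "i \<ge> d - 1" for i
          using that t by (auto simp: q_def coeff_monom_mult t_def coeff_eq_0)
        then have "q \<cdot> x \<in> H" using H(2) krylov_iff by blast
        then have "coeff p t *s (u ^^ (d - 1)) x \<in> H"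
          using inH H(1) subspace_diff by fastforce
        then have "inverse (coeff p t) *s (coeff p t *s (u ^^ (d - 1)) x) \<in> H"
          using H(1) subspace_scale by blast
        then show False using H(3) ct by simp
      qed
      then show "z \<in> {0}" using p by simp
    qed
    have cyc: "subspace (cyclic x)" using cyclic_stable stable_subspace by blast
    have sub: "span (cyclic x \<union> W d) \<subseteq> V"
      using cyclic_minimal[OF V x(1)] subV by (intro span_minimal) (auto simp: W_def)
    have dims: "dim (span (cyclic x \<union> W d)) = d + dim (W d)"
      using dim_direct_sum[OF cyc subW int] dim_cyclic[OF x(2)] by (simp add: d_def)
    have eq: "span (cyclic x \<union> W d) = V"
      by (rule subspace_dim_equal) (use sub subV dims codim[of d] in auto)
    show ?thesis
    proof (rule that[OF stW _ int eq])
      show "W d \<subseteq> V" by (auto simp: W_def)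
      show "dim V = degree m + dim (W d)" using dims unfolding eq by (simp only: d_def)
    qed
  qed
qed

text \<open>
  The rational canonical form. Instead of directness of the sum the conclusion records that the
  degrees add up to the dimension; this makes the order of the summands irrelevant and gives the
  independence of the union of the Krylov bases by counting. The cyclic vector with the largest
  annihilator is split off first and put at the end of the list.
\<close>
lemma cyclic_decomposition:
  assumes "stable V"
  obtains L where "\<And>x P. (x, P) \<in> set L \<Longrightarrow> x \<in> V \<and> lead_coeff P = 1 \<and> degree P > 0 \<and> P \<cdot> x = 0"
    "sorted_wrt (dvd) (map snd L)" "V = span (\<Union>(x, P)\<in>set L. krylov x (degree P))"
    "(\<Sum>(x, P)\<leftarrow>L. degree P) = dim V"
proof -
  have "\<exists>L. (\<forall>(x, P)\<in>set L. x \<in> V \<and> lead_coeff P = 1 \<and> degree P > 0 \<and> P \<cdot> x = 0) \<and>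
    (\<forall>(x, P)\<in>set L. \<forall>p. (\<forall>y\<in>V. p \<cdot> y = 0) \<longrightarrow> P dvd p) \<and>
    sorted_wrt (dvd) (map snd L) \<and> V = span (\<Union>(x, P)\<in>set L. krylov x (degree P)) \<and>
    (\<Sum>(x, P)\<leftarrow>L. degree P) = dim V"
    using assms
  proof (induction "dim V" arbitrary: V rule: less_induct)
    case less
    have subV: "subspace V" using less.prems stable_subspace by blast
    show ?case
    proof (cases "dim V = 0")
      case True
      then have "V \<subseteq> {0}" by simp
      then have "V = {0}" using subV subspace_0 by blast
      then show ?thesis by (intro exI[of _ "[]"]) simp
    next
      case False
      obtain m where m: "is_min_poly V m" using min_poly_exists by blast
      obtain x where x: "x \<in> V" "is_min_poly {x} m" using max_vector[OF less.prems m] by blast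
      obtain W where W: "stable W" "W \<subseteq> V" "cyclic x \<inter> W \<subseteq> {0}" "span (cyclic x \<union> W) = V"
          "dim V = degree m + dim W"
        using cyclic_complement[OF less.prems x is_min_poly_kills[OF m]] by metis
      have m1: "lead_coeff m = 1" using m by (simp add: is_min_poly_def)
      have "degree m > 0"
      proof (rule ccontr)
        assume "\<not> ?thesis"
        then have "m = 1" using m1 by (metis degree_eq_zeroE lead_coeff_pCons(2) one_pCons gr0I)
        then have "V \<subseteq> {0}" using is_min_poly_kills[OF m] by auto
        then show False using False by simp
      qed
      then obtain L where L: "\<forall>(x, P)\<in>set L. x \<in> W \<and> lead_coeff P = 1 \<and> degree P > 0 \<and> P \<cdot> x = 0"
          "\<forall>(x, P)\<in>set L. \<forall>p. (\<forall>y\<in>W. p \<cdot> y = 0) \<longrightarrow> P dvd p"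
          "sorted_wrt (dvd) (map snd L)" "W = span (\<Union>(x, P)\<in>set L. krylov x (degree P))"
          "(\<Sum>(x, P)\<leftarrow>L. degree P) = dim W"
        using less.hyps[of W] W by auto
      have div: "\<forall>(x, P)\<in>set L. P dvd m"
      proof -
        have "\<forall>y\<in>W. m \<cdot> y = 0" using W(2) is_min_poly_kills[OF m] by blast
        then show ?thesis using L(2) by auto
      qed
      have "V = span (cyclic x \<union> span (\<Union>(x, P)\<in>set L. krylov x (degree P)))"
        using W(4) L(4) by simp
      also have "cyclic x = krylov x (degree m)"
        by (rule cyclic_eq_krylov) (use x m is_min_poly_nonzero is_min_poly_kills[OF m] in auto)
      finally have "V = span (krylov x (degree m) \<union> span (\<Union>(x, P)\<in>set L. krylov x (degree P)))" .
      then have V: "V = span (krylov x (degree m) \<union> (\<Union>(x, P)\<in>set L. krylov x (degree P)))"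
        unfolding span_Un span_span .
      show ?thesis
      proof (intro exI[of _ "L @ [(x, m)]"] conjI)
        show "\<forall>(x, P)\<in>set (L @ [(x, m)]). x \<in> V \<and> lead_coeff P = 1 \<and> degree P > 0 \<and> P \<cdot> x = 0"
        proof -
          have "y \<in> V \<and> lead_coeff P = 1 \<and> degree P > 0 \<and> P \<cdot> y = 0" if "(y, P) \<in> set L" for y P
            using L(1) W(2) that by blast
          then show ?thesis
            using x(1) m1 \<open>degree m > 0\<close> is_min_poly_kills[OF m x(1)] by auto
        qed
        show "\<forall>(x, P)\<in>set (L @ [(x, m)]). \<forall>p. (\<forall>y\<in>V. p \<cdot> y = 0) \<longrightarrow> P dvd p"
        proof -
          have "P dvd p" if "(y, P) \<in> set L" "\<forall>y\<in>V. p \<cdot> y = 0" for y P p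
            using L(2) W(2) that by blast
          moreover have "m dvd p" if "\<forall>y\<in>V. p \<cdot> y = 0" for p
            using m that by (simp add: is_min_poly_def)
          ultimately show ?thesis by auto
        qed
        show "sorted_wrt (dvd) (map snd (L @ [(x, m)]))"
          using L(3) div by (simp add: sorted_wrt_append) fastforce
        show "V = span (\<Union>(x, P)\<in>set (L @ [(x, m)]). krylov x (degree P))"
          using V unfolding set_append UN_Un list.set by (simp only: UN_insert UN_empty prod.case Un_empty_right Un_empty_left Un_commute)
        show "(\<Sum>(x, P)\<leftarrow>L @ [(x, m)]. degree P) = dim V" using L(5) W(5) by simp
      qed
    qed
  qed
  then obtain L where L: "\<forall>(x, P)\<in>set L. x \<in> V \<and> lead_coeff P = 1 \<and> degree P > 0 \<and> P \<cdot> x = 0"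
    "sorted_wrt (dvd) (map snd L)" "V = span (\<Union>(x, P)\<in>set L. krylov x (degree P))"
    "(\<Sum>(x, P)\<leftarrow>L. degree P) = dim V" by (elim exE conjE)
  show ?thesis
  proof (rule that[of L])
    show "x \<in> V \<and> lead_coeff P = 1 \<and> degree P > 0 \<and> P \<cdot> x = 0" if "(x, P) \<in> set L" for x P
      using L(1) that by blast
  qed (fact L)+
qed

section \<open>Composites from alternating generators\<close>

text \<open>
  The sets \<open>A\<close> and \<open>B\<close> generate \<open>V\<close>, and \<open>u - c\<close> and \<open>u - d\<close> map the span of \<open>A\<close> into that of \<open>B\<close> and vice
  versa. If \<open>n\<close> is the dimension of \<open>V\<close>, then \<open>A\<close> and \<open>B\<close> form a basis together; with a free bound \<open>n\<close>
  the property is additive without any assumption of independence.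
\<close>
definition alternating :: "'k \<Rightarrow> 'k \<Rightarrow> 'e set \<Rightarrow> nat \<Rightarrow> bool" where
  "alternating c d V n \<longleftrightarrow> (\<exists>A B. finite A \<and> finite B \<and> card A + card B \<le> n \<and> span (A \<union> B) = V \<and>
     (\<forall>a\<in>A. [:- c, 1:] \<cdot> a \<in> span B) \<and> (\<forall>b\<in>B. [:- d, 1:] \<cdot> b \<in> span A))"

lemma alternating_sym: "alternating c d V n \<Longrightarrow> alternating d c V n"
  unfolding alternating_def by (metis Un_commute add.commute)

lemma alternating_zero: "alternating c d {0} 0"
  unfolding alternating_def by (intro exI[of _ "{}"]) simp

lemma alternating_Un:
  assumes "alternating c d V n" "alternating c d V' n'"
  shows "alternating c d (span (V \<union> V')) (n + n')"
proof -
  obtain A B where 1: "finite A" "finite B" "card A + card B \<le> n" "span (A \<union> B) = V"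
     "\<And>a. a \<in> A \<Longrightarrow> [:- c, 1:] \<cdot> a \<in> span B" "\<And>b. b \<in> B \<Longrightarrow> [:- d, 1:] \<cdot> b \<in> span A"
    using assms(1) unfolding alternating_def by blast
  obtain A' B' where 2: "finite A'" "finite B'" "card A' + card B' \<le> n'" "span (A' \<union> B') = V'"
     "\<And>a. a \<in> A' \<Longrightarrow> [:- c, 1:] \<cdot> a \<in> span B'" "\<And>b. b \<in> B' \<Longrightarrow> [:- d, 1:] \<cdot> b \<in> span A'"
    using assms(2) unfolding alternating_def by blast
  have sub: "span B \<subseteq> span (B \<union> B')" "span B' \<subseteq> span (B \<union> B')"
    "span A \<subseteq> span (A \<union> A')" "span A' \<subseteq> span (A \<union> A')" by (auto intro!: span_mono)
  show ?thesis
    unfolding alternating_def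
  proof (rule exI[of _ "A \<union> A'"], rule exI[of _ "B \<union> B'"], intro conjI ballI)
    show "card (A \<union> A') + card (B \<union> B') \<le> n + n'"
      using card_Un_le[of A A'] card_Un_le[of B B'] 1(3) 2(3) by simp
    have "A \<union> A' \<union> (B \<union> B') = (A \<union> B) \<union> (A' \<union> B')" by blast
    then show "span (A \<union> A' \<union> (B \<union> B')) = span (V \<union> V')"
      using 1(4) 2(4) span_Un_span by metis
    show "[:- c, 1:] \<cdot> a \<in> span (B \<union> B')" if "a \<in> A \<union> A'" for a
      using that 1(5) 2(5) sub by blast
    show "[:- d, 1:] \<cdot> b \<in> span (A \<union> A')" if "b \<in> B \<union> B'" for b
      using that 1(6) 2(6) sub by blast
  qed (use 1 2 in auto)
qed

text \<open>
  By counting, the four generating sets \<open>A, B\<close> (of \<open>V\<close>) and \<open>A', B'\<close> (of \<open>V'\<close>) form a basis, on which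
  the idempotents can be prescribed: \<open>p\<close> is \<open>\<alpha>\<inverse> u\<close> on \<open>A\<close> and \<open>A'\<close>, the identity on \<open>B\<close> and \<open>0\<close> on \<open>B'\<close>,
  whereas \<open>q\<close> vanishes on \<open>A\<close> and \<open>A'\<close> and is \<open>\<beta>\<inverse> (u - \<alpha>)\<close> on \<open>B\<close> and \<open>\<beta>\<inverse> u\<close> on \<open>B'\<close>. Idempotency
  holds because each of these values is fixed by the map, or differs from the argument by a vector
  that the map kills.
\<close>
lemma composite_if_alternating:
  assumes V: "alternating 0 (\<alpha> + \<beta>) V n" and V': "alternating \<alpha> \<beta> V' n'"
    and full: "span (V \<union> V') = UNIV" and dims: "n + n' \<le> dim UNIV" and nz: "\<alpha> \<noteq> 0" "\<beta> \<noteq> 0"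
  shows "composite scale \<alpha> \<beta> u"
proof -
  interpret VP: vector_space_pair scale scale by unfold_locales
  obtain A B where 1: "finite A" "finite B" "card A + card B \<le> n" "span (A \<union> B) = V"
     "\<And>a. a \<in> A \<Longrightarrow> [:- 0, 1:] \<cdot> a \<in> span B" "\<And>b. b \<in> B \<Longrightarrow> [:- (\<alpha> + \<beta>), 1:] \<cdot> b \<in> span A"
    using V unfolding alternating_def by blast
  obtain A' B' where 2: "finite A'" "finite B'" "card A' + card B' \<le> n'" "span (A' \<union> B') = V'"
     "\<And>a. a \<in> A' \<Longrightarrow> [:- \<alpha>, 1:] \<cdot> a \<in> span B'" "\<And>b. b \<in> B' \<Longrightarrow> [:- \<beta>, 1:] \<cdot> b \<in> span A'"
    using V' unfolding alternating_def by blast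
  have uA: "u a \<in> span B" if "a \<in> A" for a using 1(5)[OF that] by (simp only: act_linear_factor scale_zero_left diff_zero)
  have uB: "u b - (\<alpha> + \<beta>) *s b \<in> span A" if "b \<in> B" for b
    using 1(6)[OF that] by (simp only: act_linear_factor)
  have uA': "u a - \<alpha> *s a \<in> span B'" if "a \<in> A'" for a using 2(5)[OF that] by (simp only: act_linear_factor)
  have uB': "u b - \<beta> *s b \<in> span A'" if "b \<in> B'" for b
    using 2(6)[OF that] by (simp only: act_linear_factor)
  let ?S = "(A \<union> B) \<union> (A' \<union> B')"
  have finS: "finite ?S" using 1 2 by simp
  have spanS: "span ?S = UNIV" using full 1(4) 2(4) span_Un_span by metis
  have cS: "dim UNIV \<le> card ?S" by (rule dim_le_card) (use spanS finS in auto)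
  \<comment> \<open>the spanning set has at least as many elements as the dimension, so no two of the four sets can overlap\<close>
  have cU: "card ?S + card ((A \<union> B) \<inter> (A' \<union> B')) = card (A \<union> B) + card (A' \<union> B')"
    "card (A \<union> B) + card (A \<inter> B) = card A + card B"
    "card (A' \<union> B') + card (A' \<inter> B') = card A' + card B'"
    using 1(1,2) 2(1,2) by (simp_all add: card_Un_Int[symmetric])
  have "card ((A \<union> B) \<inter> (A' \<union> B')) = 0" "card (A \<inter> B) = 0" "card (A' \<inter> B') = 0" 
    using cS cU dims 1(3) 2(3) by linarith+
  then have disj: "(A \<union> B) \<inter> (A' \<union> B') = {}" "A \<inter> B = {}" "A' \<inter> B' = {}" using 1 2 by auto
  have "card ?S \<le> dim UNIV" using cU dims 1(3) 2(3) by linarith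
  then have ind: "independent ?S" 
    using card_le_dim_spanning[of ?S UNIV] spanS finS by auto
  obtain p where p: "Vector_Spaces.linear scale scale p" and
    pv: "\<forall>x\<in>?S. p x = (if x \<in> A \<union> A' then inverse \<alpha> *s u x else if x \<in> B then x else 0)"
    using VP.linear_independent_extend[OF ind,
        of "\<lambda>x. if x \<in> A \<union> A' then inverse \<alpha> *s u x else if x \<in> B then x else 0"] by blast
  obtain q where q: "Vector_Spaces.linear scale scale q" and
    qv: "\<forall>x\<in>?S. q x = (if x \<in> B then inverse \<beta> *s (u x - \<alpha> *s x) else if x \<in> B' then inverse \<beta> *s u x else 0)"
    using VP.linear_independent_extend[OF ind, of "\<lambda>x. if x \<in> B then inverse \<beta> *s (u x - \<alpha> *s x)
        else if x \<in> B' then inverse \<beta> *s u x else 0"] by blast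
  interpret p: Vector_Spaces.linear scale scale p by (rule p)
  interpret q: Vector_Spaces.linear scale scale q by (rule q)
  have ext: "f = g" if "Vector_Spaces.linear scale scale f" "Vector_Spaces.linear scale scale g"
      "\<And>x. x \<in> ?S \<Longrightarrow> f x = g x" for f g
    using VP.linear_eq_on[OF that(1,2), of _ ?S] that(3) spanS by (intro ext) auto
  have pA: "p a = inverse \<alpha> *s u a" if "a \<in> A" for a using pv that by simp
  have pA': "p a = inverse \<alpha> *s u a" if "a \<in> A'" for a using pv that by simp
  have pB: "p b = b" if "b \<in> B" for b using pv that disj by auto
  have pB': "p b = 0" if "b \<in> B'" for b using pv that disj by auto
  have qA: "q a = 0" if "a \<in> A" for a using qv that disj by auto
  have qA': "q a = 0" if "a \<in> A'" for a using qv that disj by auto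
  have qB: "q b = inverse \<beta> *s (u b - \<alpha> *s b)" if "b \<in> B" for b using qv that by simp
  have qB': "q b = inverse \<beta> *s u b" if "b \<in> B'" for b using qv that disj by auto
  have pspanB: "p x = x" if "x \<in> span B" for x
    using VP.linear_eq_on[OF p linear_id that] pB by blast
  have pspanB': "p x = 0" if "x \<in> span B'" for x using p.eq_0_on_span[OF pB' that] .
  have qspanA: "q x = 0" if "x \<in> span A" for x using q.eq_0_on_span[OF qA that] .
  have qspanA': "q x = 0" if "x \<in> span A'" for x using q.eq_0_on_span[OF qA' that] .
  have "p \<circ> p = p"
  proof (rule ext[OF Vector_Spaces.linear_compose[OF p p] p])
    fix x assume "x \<in> ?S"
    then consider "x \<in> A" | "x \<in> B" | "x \<in> A'" | "x \<in> B'" by blast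
    then show "(p \<circ> p) x = p x"
    proof cases
      case 1 then show ?thesis using pspanB[OF uA] by (simp add: pA p.scale)
    next
      case 2 then show ?thesis by (simp add: pB)
    next
      case 3
      have "p (inverse \<alpha> *s u x) = p (x + inverse \<alpha> *s (u x - \<alpha> *s x))"
        using nz by (simp add: scale_right_diff_distrib)
      also have "\<dots> = p x" using pspanB'[OF uA'[OF 3]] by (simp only: p.add p.scale) simp
      finally show ?thesis using 3 by (simp add: pA')
    next
      case 4 then show ?thesis by (simp add: pB' p.zero)
    qed
  qed
  moreover have "q \<circ> q = q"
  proof (rule ext[OF Vector_Spaces.linear_compose[OF q q] q])
    fix x assume "x \<in> ?S"
    then consider "x \<in> A" | "x \<in> B" | "x \<in> A'" | "x \<in> B'" by blast
    then show "(q \<circ> q) x = q x"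
    proof cases
      case 1 then show ?thesis by (simp add: qA q.zero)
    next
      case 2
      have "q (inverse \<beta> *s (u x - \<alpha> *s x)) = q (x + inverse \<beta> *s (u x - (\<alpha> + \<beta>) *s x))"
        using nz by (simp add: scale_right_diff_distrib scale_left_distrib scale_right_distrib)
      also have "\<dots> = q x" using qspanA[OF uB[OF 2]] by (simp only: q.add q.scale) simp
      finally show ?thesis using 2 by (simp add: qB)
    next
      case 3 then show ?thesis by (simp add: qA' q.zero)
    next
      case 4
      have "q (inverse \<beta> *s u x) = q (x + inverse \<beta> *s (u x - \<beta> *s x))"
        using nz by (simp add: scale_right_diff_distrib)
      also have "\<dots> = q x" using qspanA'[OF uB'[OF 4]] by (simp only: q.add q.scale) simp
      finally show ?thesis using 4 by (simp add: qB')
    qed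
  qed
  moreover have "u = (\<lambda>v. \<alpha> *s p v + \<beta> *s q v)"
  proof (rule ext[OF linear_u])
    show "Vector_Spaces.linear scale scale (\<lambda>v. \<alpha> *s p v + \<beta> *s q v)"
      by (intro VP.module_hom_add VP.module_hom_scale p q)
    fix x assume "x \<in> ?S"
    then consider "x \<in> A" | "x \<in> B" | "x \<in> A'" | "x \<in> B'" by blast
    then show "u x = \<alpha> *s p x + \<beta> *s q x"
      by cases (use nz in \<open>simp_all add: pA pA' pB pB' qA qA' qB qB'\<close>)
  qed
  ultimately show ?thesis unfolding composite_def using p q by blast
qed

text \<open>
  With \<open>C = (X - d) (X - c)\<close>, take \<open>A\<close> to consist of \<open>a\<close> vectors \<open>C\<^sup>j z\<close> and \<open>B\<close> of \<open>b\<close> vectors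
  \<open>(X - c) C\<^sup>j z\<close>. Applying \<open>X - c\<close> and \<open>X - d\<close> in turn runs through the chain
  \<open>z, (X - c) z, C z, (X - c) C z, \<dots>\<close>, and the hypothesis says where the chain closes: after \<open>2 a\<close> terms,
  or after \<open>2 a - 1\<close> terms with \<open>0\<close>.
\<close>
lemma alternating_cyclic:
  fixes c d :: 'k and z :: 'e
  defines "C \<equiv> [:- d, 1:] * [:- c, 1:]"
  assumes close: "(a = b \<and> C ^ a \<cdot> z \<in> span ((\<lambda>j. C ^ j \<cdot> z) ` {..<a})) \<or>
    (a = Suc b \<and> ([:- c, 1:] * C ^ b) \<cdot> z = 0)"
  shows "alternating c d (cyclic z) (a + b)"
proof -
  let ?A = "(\<lambda>j. C ^ j \<cdot> z) ` {..<a}"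
  let ?B = "(\<lambda>j. ([:- c, 1:] * C ^ j) \<cdot> z) ` {..<b}"
  have A: "[:- c, 1:] \<cdot> y \<in> span ?B" if y: "y \<in> ?A" for y
  proof -
    obtain j where j: "j < a" "y = C ^ j \<cdot> z" using y by blast
    have y: "[:- c, 1:] \<cdot> y = ([:- c, 1:] * C ^ j) \<cdot> z" by (simp only: j act_mult)
    show ?thesis
    proof (cases "j < b")
      case True then show ?thesis unfolding y by (intro span_base) blast
    next
      case False
      then have "a = Suc b" "j = b" using close j by auto
      then show ?thesis unfolding y using close span_zero by auto
    qed
  qed
  have B: "[:- d, 1:] \<cdot> y \<in> span ?A" if y: "y \<in> ?B" for y
  proof -
    obtain j where j: "j < b" "y = ([:- c, 1:] * C ^ j) \<cdot> z" using y by blast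
    have y: "[:- d, 1:] \<cdot> y = C ^ Suc j \<cdot> z"
      by (simp only: j act_mult[symmetric] C_def power_Suc mult.assoc)
    show ?thesis
    proof (cases "Suc j < a")
      case True then show ?thesis unfolding y by (intro span_base) blast
    next
      case False
      then have "a = b" "Suc j = a" using close j by auto
      then show ?thesis unfolding y using close by auto
    qed
  qed
  have eq: "span (?A \<union> ?B) = cyclic z"
  proof
    have "?A \<union> ?B \<subseteq> cyclic z" unfolding cyclic_def by blast
    then show "span (?A \<union> ?B) \<subseteq> cyclic z"
      using cyclic_stable stable_subspace span_minimal by blast
    have u: "u y \<in> span (?A \<union> ?B)" if "y \<in> ?A \<union> ?B" for y
    proof -
      have y: "y \<in> span (?A \<union> ?B)" using that by (rule span_base)
      have "\<exists>e. [:- e, 1:] \<cdot> y \<in> span (?A \<union> ?B)"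
        using that A[of y] B[of y] span_mono[of ?A "?A \<union> ?B"] span_mono[of ?B "?A \<union> ?B"] by blast
      then obtain e where "u y - e *s y \<in> span (?A \<union> ?B)" by (auto simp: act_linear_factor)
      then have "(u y - e *s y) + e *s y \<in> span (?A \<union> ?B)"
        using y by (intro span_add span_scale)
      then show ?thesis by simp
    qed
    have "span (?A \<union> ?B) \<subseteq> {y. u y \<in> span (?A \<union> ?B)}"
    proof (rule span_minimal)
      interpret Vector_Spaces.linear scale scale u by (rule linear_u)
      show "subspace {y. u y \<in> span (?A \<union> ?B)}" by (rule subspace_linear_preimage) simp
    qed (use u in blast)
    then have st: "stable (span (?A \<union> ?B))" by (auto simp: stable_def)
    have "z \<in> span (?A \<union> ?B)"
    proof (cases "a = 0")
      case True
      then have "z \<in> span {}" using close by auto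
      then show ?thesis using span_zero by simp
    next
      case False
      then have "C ^ 0 \<cdot> z \<in> ?A" by blast
      then have "z \<in> ?A \<union> ?B" by simp
      then show ?thesis by (rule span_base)
    qed
    then show "cyclic z \<subseteq> span (?A \<union> ?B)" using cyclic_minimal[OF st] by blast
  qed
  have "card ?A \<le> a" "card ?B \<le> b" using card_image_le[of "{..<a}"] card_image_le[of "{..<b}"] by auto
  then have "card ?A + card ?B \<le> a + b" by simp
  then show ?thesis
    unfolding alternating_def
    by - (rule exI[of _ ?A], rule exI[of _ ?B], intro conjI ballI; (rule A B eq)?; simp)
qed

text \<open>
  The Bezout coefficients recover \<open>x\<close> and \<open>y\<close> from \<open>x + y\<close>.
\<close>
lemma cyclic_sum:
  assumes co: "comaximal p q" and "p \<cdot> x = 0" "q \<cdot> y = 0"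
  shows "span (cyclic x \<union> cyclic y) = cyclic (x + y)"
proof
  obtain a b where ab: "a * p + b * q = 1" using co comaximal_def by blast
  have "(b * q) \<cdot> (x + y) = (a * p + b * q) \<cdot> x"
    using assms by (simp add: act_add act_mult act_add_right)
  then have x: "(b * q) \<cdot> (x + y) = x" using ab by simp
  have "(a * p) \<cdot> (x + y) = (a * p + b * q) \<cdot> y"
    using assms by (simp add: act_add act_mult act_add_right)
  then have y: "(a * p) \<cdot> (x + y) = y" using ab by simp
  have st: "stable (cyclic (x + y))" by (rule cyclic_stable)
  have "x \<in> cyclic (x + y)" "y \<in> cyclic (x + y)" unfolding cyclic_def using x y by (metis rangeI)+
  then have "cyclic x \<union> cyclic y \<subseteq> cyclic (x + y)" using cyclic_minimal[OF st] by blast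
  then show "span (cyclic x \<union> cyclic y) \<subseteq> cyclic (x + y)"
    using st stable_subspace span_minimal by blast
  have "x + y \<in> span (cyclic x \<union> cyclic y)"
    using cyclic_self by (intro span_add span_base) auto
  then show "cyclic (x + y) \<subseteq> span (cyclic x \<union> cyclic y)"
    using cyclic_minimal stable_span_Un cyclic_stable by blast
qed

lemma alternating_pair_aux:
  assumes "c \<noteq> d" and x: "[:- c, 1:] ^ l \<cdot> x = 0" and y: "[:- d, 1:] ^ m \<cdot> y = 0"
    and lm: "l = m \<or> l = Suc m"
  shows "alternating c d (span (cyclic x \<union> cyclic y)) (l + m)"
proof -
  define L M where "L = [:- c, 1:]" and "M = [:- d, 1:]"
  have kill: "(L ^ i * M ^ m) \<cdot> (x + y) = 0" if li: "l \<le> i" for i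
  proof -
    obtain k where k: "i = k + l" using li by (metis add.commute le_Suc_ex)
    have "(L ^ i * M ^ m) \<cdot> x = (L ^ k * M ^ m) \<cdot> (L ^ l \<cdot> x)"
      by (simp add: act_mult[symmetric] k power_add ac_simps)
    moreover have "(L ^ i * M ^ m) \<cdot> y = 0" using y by (simp add: act_mult M_def)
    ultimately show ?thesis using x by (simp add: act_add_right L_def)
  qed
  have "alternating c d (cyclic (x + y)) (l + m)"
  proof (rule alternating_cyclic, fold L_def M_def)
    show "l = m \<and> (M * L) ^ l \<cdot> (x + y) \<in> span ((\<lambda>j. (M * L) ^ j \<cdot> (x + y)) ` {..<l}) \<or>
        l = Suc m \<and> (L * (M * L) ^ m) \<cdot> (x + y) = 0"
      using lm
    proof
      assume "l = m"
      moreover have "(M * L) ^ l \<cdot> (x + y) = 0"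
        using kill[of l] \<open>l = m\<close> by (simp add: power_mult_distrib mult.commute)
      ultimately show ?thesis using span_zero by simp
    next
      assume "l = Suc m"
      moreover have "(L * (M * L) ^ m) \<cdot> (x + y) = 0"
        using kill[of l] \<open>l = Suc m\<close> by (simp add: power_mult_distrib ac_simps)
      ultimately show ?thesis by simp
    qed
  qed
  moreover have "span (cyclic x \<union> cyclic y) = cyclic (x + y)"
    by (rule cyclic_sum[OF comaximal_linear_powers x y]) (rule assms)
  ultimately show ?thesis by simp
qed

text \<open>
  A Jordan block of size \<open>l\<close> for \<open>c\<close> and one of size \<open>m\<close> for \<open>d\<close> together form the cyclic space of \<open>x + y\<close>,
  whose generator is killed by \<open>(X - c)\<^sup>l (X - d)\<^sup>m\<close>: an alternating product of the two factors
  if \<open>l\<close> and \<open>m\<close> differ by at most one.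
\<close>
lemma alternating_pair:
  assumes "c \<noteq> d" and x: "[:- c, 1:] ^ l \<cdot> x = 0" and y: "[:- d, 1:] ^ m \<cdot> y = 0"
    and "l \<le> Suc m" "m \<le> Suc l"
  shows "alternating c d (span (cyclic x \<union> cyclic y)) (l + m)"
proof -
  consider "l = m \<or> l = Suc m" | "m = l \<or> m = Suc l" using assms by linarith
  then show ?thesis
  proof cases
    case 1 then show ?thesis using alternating_pair_aux assms by blast
  next
    case 2
    then have "alternating d c (span (cyclic y \<union> cyclic x)) (m + l)"
      using alternating_pair_aux[OF _ y x] assms by blast
    then show ?thesis using alternating_sym by (simp add: Un_commute add.commute)
  qed
qed

section \<open>Pairing Jordan blocks\<close>

text \<open>
  A relative version of the dimensions behind \<^term>\<open>kernel_jump\<close>, so that Jordan blocks can be removed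
  one after the other.
\<close>
definition kernel_dim :: "'e set \<Rightarrow> 'k \<Rightarrow> nat \<Rightarrow> nat" where
  "kernel_dim V c k = dim (V \<inter> {x. [:- c, 1:] ^ k \<cdot> x = 0})"

lemma shifted_endo_power: "(shifted_endo scale u c ^^ k) x = [:- c, 1:] ^ k \<cdot> x"
proof -
  have "shifted_endo scale u c = (\<lambda>x. [:- c, 1:] \<cdot> x)"
    by (simp only: shifted_endo_def act_linear_factor)
  then show ?thesis by (simp only: act_power)
qed

lemma kernel_dim_UNIV: "kernel_dim UNIV c k = dim {x. [:- c, 1:] ^ k \<cdot> x = 0}"
  by (simp add: kernel_dim_def)

lemma kernel_jump_kernel_dim:
  "kernel_jump scale u c k = kernel_dim UNIV c k - kernel_dim UNIV c (k - 1)"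
  unfolding kernel_jump_def kernel_dim_UNIV shifted_endo_power ..

lemma kernel_dim_mono: "kernel_dim V c k \<le> kernel_dim V c (Suc k)"
  unfolding kernel_dim_def
  by (rule dim_subset) (auto simp: act_mult simp del: mult_pCons_left mult_pCons_right)

lemma kernel_dim_stable:
  assumes "\<And>x. x \<in> V \<Longrightarrow> [:- c, 1:] ^ l \<cdot> x = 0" "l \<le> k" shows "kernel_dim V c k = dim V"
proof -
  have "[:- c, 1:] ^ k \<cdot> x = 0" if "x \<in> V" for x
  proof -
    have "[:- c, 1:] ^ k = [:- c, 1:] ^ (k - l) * [:- c, 1:] ^ l"
      using assms(2) by (simp only: power_add[symmetric] le_add_diff_inverse2)
    then show ?thesis using assms(1) that by (simp only: act_mult act_0_right)
  qed
  then have "V \<inter> {x. [:- c, 1:] ^ k \<cdot> x = 0} = V" by blast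
  then show ?thesis by (simp add: kernel_dim_def)
qed

text \<open>
  A single Jordan block: for \<open>k < l\<close> the kernel of \<open>(u - c)\<^sup>k\<close> is the cyclic space of \<open>(u - c)\<^sup>l\<^sup>-\<^sup>k x\<close>.
\<close>
lemma kernel_dim_cyclic:
  assumes x: "is_min_poly {x} ([:- c, 1:] ^ l)"
  shows "kernel_dim (cyclic x) c k = min l k"
proof (cases "l \<le> k")
  case True
  have "[:- c, 1:] ^ l \<cdot> y = 0" if "y \<in> cyclic x" for y
    using that is_min_poly_kills[OF x] by (auto simp: cyclic_def act_commute[of "[:- c, 1:] ^ l"])
  then have "kernel_dim (cyclic x) c k = dim (cyclic x)"
    using True by (rule kernel_dim_stable)
  then show ?thesis using dim_cyclic[OF x] True by (simp add: degree_linear_power)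
next
  case False
  define L where "L = [:- c, 1:]"
  have L: "L \<noteq> 0" by (simp add: L_def)
  have Ll: "L ^ l = L ^ k * L ^ (l - k)" using False by (simp only: power_add[symmetric]) simp
  have iff: "p \<cdot> x = 0 \<longleftrightarrow> L ^ k * L ^ (l - k) dvd p" for p
    using x by (simp add: min_poly_singleton L_def[symmetric] Ll[symmetric])
  have "is_min_poly {L ^ (l - k) \<cdot> x} (L ^ k)"
    unfolding min_poly_singleton
  proof (intro conjI allI)
    show "lead_coeff (L ^ k) = 1" by (simp add: lead_coeff_power L_def)
    fix p
    show "p \<cdot> (L ^ (l - k) \<cdot> x) = 0 \<longleftrightarrow> L ^ k dvd p"
      using iff[of "p * L ^ (l - k)"] L by (simp add: act_mult)
  qed
  then have "dim (cyclic (L ^ (l - k) \<cdot> x)) = k"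
    using dim_cyclic by (simp add: L_def degree_linear_power)
  moreover have "cyclic x \<inter> {y. L ^ k \<cdot> y = 0} = cyclic (L ^ (l - k) \<cdot> x)"
  proof
    show "cyclic x \<inter> {y. L ^ k \<cdot> y = 0} \<subseteq> cyclic (L ^ (l - k) \<cdot> x)"
    proof
      fix y assume y: "y \<in> cyclic x \<inter> {y. L ^ k \<cdot> y = 0}"
      then obtain p where p: "y = p \<cdot> x" "(L ^ k * p) \<cdot> x = 0" by (auto simp: cyclic_def act_mult)
      then have "L ^ (l - k) dvd p" using iff L by simp
      then obtain r where "p = r * L ^ (l - k)" by (metis dvdE mult.commute)
      then show "y \<in> cyclic (L ^ (l - k) \<cdot> x)" using p by (auto simp: cyclic_def act_mult)
    qed
    show "cyclic (L ^ (l - k) \<cdot> x) \<subseteq> cyclic x \<inter> {y. L ^ k \<cdot> y = 0}"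
    proof (intro Int_greatest)
      have "L ^ (l - k) \<cdot> x \<in> cyclic x" by (auto simp: cyclic_def)
      then show "cyclic (L ^ (l - k) \<cdot> x) \<subseteq> cyclic x" using cyclic_minimal[OF cyclic_stable] by blast
      have "L ^ k \<cdot> (L ^ (l - k) \<cdot> x) = 0"
        using iff[of "L ^ k * L ^ (l - k)"] by (simp add: act_mult)
      then show "cyclic (L ^ (l - k) \<cdot> x) \<subseteq> {y. L ^ k \<cdot> y = 0}"
        using cyclic_minimal[OF stable_kernel] by blast
    qed
  qed
  ultimately show ?thesis using False by (simp add: kernel_dim_def L_def)
qed

text \<open>
  The kernel of a polynomial in \<open>u\<close> respects a direct sum of stable spaces.
\<close>
lemma kernel_dim_direct_sum:
  assumes st: "stable X" "stable W" and int: "X \<inter> W \<subseteq> {0}"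
  shows "kernel_dim (span (X \<union> W)) c k = kernel_dim X c k + kernel_dim W c k"
proof -
  define K where "K = {x. [:- c, 1:] ^ k \<cdot> x = 0}"
  have K: "subspace K" unfolding K_def by (rule subspace_act_kernel)
  have sX: "subspace X" and sW: "subspace W" using st stable_subspace by auto
  have "span (X \<union> W) \<inter> K = span ((X \<inter> K) \<union> (W \<inter> K))"
  proof
    show "span (X \<union> W) \<inter> K \<subseteq> span ((X \<inter> K) \<union> (W \<inter> K))"
    proof
      fix v assume v: "v \<in> span (X \<union> W) \<inter> K"
      then have "v \<in> {x + y |x y. x \<in> span X \<and> y \<in> span W}" using span_Un by blast
      then obtain x w where xw: "v = x + w" "x \<in> X" "w \<in> W"
        using sX sW by (auto simp: span_eq_iff[THEN iffD2])
      let ?a = "\<lambda>x. [:- c, 1:] ^ k \<cdot> x"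
      have "?a x + ?a w = 0" using v xw by (simp add: K_def act_add_right)
      then have eq: "?a x = - ?a w" by (simp add: eq_neg_iff_add_eq_0)
      have "?a x \<in> X" "?a w \<in> W" using st xw stable_act by blast+
      then have "?a x \<in> X \<inter> W" using eq sW subspace_neg by auto
      then have "?a x = 0" using int by blast
      then have "x \<in> X \<inter> K" "w \<in> W \<inter> K" using xw eq by (auto simp: K_def)
      then show "v \<in> span ((X \<inter> K) \<union> (W \<inter> K))"
        unfolding xw(1) by (metis UnI1 UnI2 span_add span_base)
    qed
    show "span ((X \<inter> K) \<union> (W \<inter> K)) \<subseteq> span (X \<union> W) \<inter> K"
      by (rule span_minimal) (use K in \<open>auto intro: span_base subspace_inter\<close>)
  qed
  moreover have "dim (span ((X \<inter> K) \<union> (W \<inter> K))) = dim (X \<inter> K) + dim (W \<inter> K)"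
    by (rule dim_direct_sum) (use K sX sW int in \<open>auto intro: subspace_inter\<close>)
  ultimately show ?thesis by (simp add: kernel_dim_def K_def)
qed

lemma nilpotent_max_vector:
  assumes V: "stable V" and nil: "\<And>x. x \<in> V \<Longrightarrow> [:- c, 1:] ^ N \<cdot> x = 0"
  obtains l x where "x \<in> V" "is_min_poly {x} ([:- c, 1:] ^ l)"
    "\<And>x. x \<in> V \<Longrightarrow> [:- c, 1:] ^ l \<cdot> x = 0"
proof -
  define L where "L = [:- c, 1:]"
  define l where "l = (LEAST l. \<forall>x\<in>V. L ^ l \<cdot> x = 0)"
  have l: "\<forall>x\<in>V. L ^ l \<cdot> x = 0"
    unfolding l_def by (rule LeastI[of _ N]) (use nil L_def in auto)
  have lead: "lead_coeff (L ^ l) = 1" by (simp add: lead_coeff_power L_def)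
  have "\<exists>x\<in>V. is_min_poly {x} (L ^ l)"
  proof (cases "l = 0")
    case True
    then have "is_min_poly {0} (L ^ l)" by (simp add: min_poly_singleton)
    moreover have "0 \<in> V" using V stable_subspace subspace_0 by blast
    ultimately show ?thesis by blast
  next
    case False
    then have "\<not> (\<forall>x\<in>V. L ^ (l - 1) \<cdot> x = 0)"
      using not_less_Least[of "l - 1" "\<lambda>l. \<forall>x\<in>V. L ^ l \<cdot> x = 0"] l_def by auto
    then obtain x where x: "x \<in> V" "L ^ (l - 1) \<cdot> x \<noteq> 0" by blast
    have irr: "irreducible L" unfolding L_def by (rule irreducible_linear_field_poly) simp
    have "p \<cdot> x = 0 \<longleftrightarrow> L ^ l dvd p" for p
    proof
      assume "p \<cdot> x = 0"
      then show "L ^ l dvd p" using prime_power_dvd_annihilator[OF irr _ x(2)] l x by blast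
    next
      assume "L ^ l dvd p"
      then obtain r where "p = r * L ^ l" by (metis dvdE mult.commute)
      then show "p \<cdot> x = 0" using l x by (simp add: act_mult)
    qed
    then show ?thesis using x lead by (auto simp: min_poly_singleton)
  qed
  then show ?thesis using that l unfolding L_def by blast
qed

text \<open>
  Split off a longest Jordan block from each space, of sizes \<open>l\<close> and \<open>m\<close>. The jump of \<open>V\<close> at \<open>l\<close> is positive
  and that of \<open>W\<close> vanishes beyond \<open>m\<close>, so intertwining gives \<open>l \<le> m + 1\<close>, and symmetrically
  \<open>m \<le> l + 1\<close>; hence the two blocks form an alternating pair (one of them may be zero). The removal lowers
  the jumps of \<open>V\<close> at \<open>k \<le> l\<close> and those of \<open>W\<close> at \<open>k \<le> m\<close> by one, and what remains is again intertwined: if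
  \<open>k + 1 \<le> m\<close>, both sides of \<open>w (k + 1) \<le> v k\<close> are lowered by one, and otherwise the left side becomes
  zero.
\<close>
lemma alternating_if_intertwined:
  assumes cd: "c \<noteq> d" and "stable V" "stable W"
    and "\<And>x. x \<in> V \<Longrightarrow> [:- c, 1:] ^ N \<cdot> x = 0" "\<And>x. x \<in> W \<Longrightarrow> [:- d, 1:] ^ M \<cdot> x = 0"
    and "intertwined (\<lambda>k. kernel_dim V c k - kernel_dim V c (k - 1))
           (\<lambda>k. kernel_dim W d k - kernel_dim W d (k - 1))"
  shows "alternating c d (span (V \<union> W)) (dim V + dim W)"
  using assms(2-)
proof (induction "dim V + dim W" arbitrary: V W rule: less_induct)
  case less
  define v w where "v = (\<lambda>k. kernel_dim V c k - kernel_dim V c (k - 1))"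
    and "w = (\<lambda>k. kernel_dim W d k - kernel_dim W d (k - 1))"
  have int: "v (Suc k) \<le> w k" "w (Suc k) \<le> v k" if "k \<ge> 1" for k
    using less.prems(5) that by (auto simp: intertwined_def v_def w_def)
  obtain l x where x: "x \<in> V" "is_min_poly {x} ([:- c, 1:] ^ l)"
    and l: "\<And>x. x \<in> V \<Longrightarrow> [:- c, 1:] ^ l \<cdot> x = 0"
    using nilpotent_max_vector[OF less.prems(1,3)] by blast
  obtain m y where y: "y \<in> W" "is_min_poly {y} ([:- d, 1:] ^ m)"
    and m: "\<And>x. x \<in> W \<Longrightarrow> [:- d, 1:] ^ m \<cdot> x = 0"
    using nilpotent_max_vector[OF less.prems(2,4)] by blast
  obtain V' where V': "stable V'" "V' \<subseteq> V" "cyclic x \<inter> V' \<subseteq> {0}" "span (cyclic x \<union> V') = V"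
      "dim V = l + dim V'"
    using cyclic_complement[OF less.prems(1) x l] by (auto simp: degree_linear_power)
  obtain W' where W': "stable W'" "W' \<subseteq> W" "cyclic y \<inter> W' \<subseteq> {0}" "span (cyclic y \<union> W') = W"
      "dim W = m + dim W'"
    using cyclic_complement[OF less.prems(2) y m] by (auto simp: degree_linear_power)
  define v' w' where "v' = (\<lambda>k. kernel_dim V' c k - kernel_dim V' c (k - 1))"
    and "w' = (\<lambda>k. kernel_dim W' d k - kernel_dim W' d (k - 1))"
  have v: "v k = (if k \<le> l then 1 else 0) + v' k" if "k \<ge> 1" for k
  proof -
    have "kernel_dim V c j = min l j + kernel_dim V' c j" for j
      using kernel_dim_direct_sum[OF cyclic_stable V'(1,3)] kernel_dim_cyclic[OF x(2)] V'(4) by simp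
    then show ?thesis
      using that kernel_dim_mono[of V' c "k - 1"] by (auto simp: v_def v'_def min_def)
  qed
  have w: "w k = (if k \<le> m then 1 else 0) + w' k" if "k \<ge> 1" for k
  proof -
    have "kernel_dim W d j = min m j + kernel_dim W' d j" for j
      using kernel_dim_direct_sum[OF cyclic_stable W'(1,3)] kernel_dim_cyclic[OF y(2)] W'(4) by simp
    then show ?thesis
      using that kernel_dim_mono[of W' d "k - 1"] by (auto simp: w_def w'_def min_def)
  qed
  have v'0: "v' k = 0" if "k > l" for k
  proof -
    have "l \<le> k" "l \<le> k - 1" using that by auto
    then show ?thesis using kernel_dim_stable[of V' c l] l V'(2) by (simp add: v'_def subset_iff)
  qed
  have w'0: "w' k = 0" if "k > m" for k
  proof -
    have "m \<le> k" "m \<le> k - 1" using that by auto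
    then show ?thesis using kernel_dim_stable[of W' d m] m W'(2) by (simp add: w'_def subset_iff)
  qed
  have lm: "l \<le> Suc m"
  proof (rule ccontr)
    assume "\<not> ?thesis"
    then have "l - 1 \<ge> 1" "l - 1 > m" by auto
    then show False using int(1)[of "l - 1"] v[of l] w[of "l - 1"] w'0[of "l - 1"] by auto
  qed
  have ml: "m \<le> Suc l"
  proof (rule ccontr)
    assume "\<not> ?thesis"
    then have "m - 1 \<ge> 1" "m - 1 > l" by auto
    then show False using int(2)[of "m - 1"] w[of m] v[of "m - 1"] v'0[of "m - 1"] by auto
  qed
  have int': "intertwined v' w'"
    unfolding intertwined_def
  proof (intro allI impI conjI)
    fix k :: nat assume k: "1 \<le> k"
    show "w' (k + 1) \<le> v' k"
      using int(2)[OF k] w[of "Suc k"] v[OF k] w'0[of "Suc k"] lm ml by (cases "Suc k \<le> m") auto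
    show "v' (k + 1) \<le> w' k"
      using int(1)[OF k] v[of "Suc k"] w[OF k] v'0[of "Suc k"] lm ml by (cases "Suc k \<le> l") auto
  qed
  show ?case
  proof (cases "l + m = 0")
    case True
    then have "V \<subseteq> {0}" "W \<subseteq> {0}" using l m by auto
    then have "V = {0}" "W = {0}" using x(1) y(1) by auto
    then show ?thesis using alternating_zero by simp
  next
    case False
    then have "dim V' + dim W' < dim V + dim W" using V'(5) W'(5) by simp
    then have "alternating c d (span (V' \<union> W')) (dim V' + dim W')"
      by (rule less.hyps[OF _ V'(1) W'(1)])
        (use less.prems(3,4) V'(2) W'(2) int' in \<open>auto simp: v'_def w'_def\<close>)
    moreover have "alternating c d (span (cyclic x \<union> cyclic y)) (l + m)"
      by (rule alternating_pair[OF cd l[OF x(1)] m[OF y(1)] lm ml])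
    ultimately have "alternating c d (span (span (cyclic x \<union> cyclic y) \<union> span (V' \<union> W')))
        ((l + m) + (dim V' + dim W'))" using alternating_Un by blast
    moreover have "span (span (cyclic x \<union> cyclic y) \<union> span (V' \<union> W')) = span (V \<union> W)"
    proof -
      have "span (V \<union> W) = span (span (cyclic x \<union> V') \<union> span (cyclic y \<union> W'))" by (simp only: V'(4) W'(4))
      also have "\<dots> = span ((cyclic x \<union> cyclic y) \<union> (V' \<union> W'))"
        unfolding span_Un_span by (simp only: Un_assoc Un_left_commute)
      finally show ?thesis unfolding span_Un_span ..
    qed
    moreover have "(l + m) + (dim V' + dim W') = dim V + dim W" using V'(5) W'(5) by simp
    ultimately show ?thesis by simp
  qed
qed

end

section \<open>Separating the exceptional eigenvalues\<close>

lemma rootfree_decomposition_exists: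
  fixes M :: "'a::field poly"
  assumes "lead_coeff M = 1"
  shows "\<exists>ls Q. set ls \<subseteq> L \<and> M = (\<Prod>l\<leftarrow>ls. [:- l, 1:]) * Q \<and> lead_coeff Q = 1 \<and> (\<forall>l\<in>L. poly Q l \<noteq> 0)"
  using assms
proof (induction "degree M" arbitrary: M rule: less_induct)
  case less
  show ?case
  proof (cases "\<exists>l\<in>L. poly M l = 0")
    case False
    then show ?thesis using less.prems by (intro exI[of _ "[]"] exI[of _ M]) auto
  next
    case True
    then obtain l where l: "l \<in> L" "poly M l = 0" by blast
    then obtain M' where M': "M = [:- l, 1:] * M'" by (auto simp: poly_eq_0_iff_dvd elim: dvdE)
    have "M' \<noteq> 0" using M' less.prems by auto
    then have "degree M = Suc (degree M')" unfolding M' by (subst degree_mult_eq) auto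
    moreover have "lead_coeff M' = 1" using less.prems unfolding M' lead_coeff_mult by simp
    ultimately obtain ls Q where "set ls \<subseteq> L" "M' = (\<Prod>l\<leftarrow>ls. [:- l, 1:]) * Q"
        "lead_coeff Q = 1" "\<forall>l\<in>L. poly Q l \<noteq> 0"
      using less.hyps[of M'] by auto
    then show ?thesis
      using l M' by (intro exI[of _ "l # ls"] exI[of _ Q]) (simp add: mult.assoc del: mult_pCons_left)
  qed
qed

text \<open>
  Any two candidates for the root-free part divide each other, since each is comaximal to all linear
  factors \<open>X - l\<close>; being monic, they agree.
\<close>
lemma rootfree_part_spec:
  fixes M :: "'a::field poly"
  assumes M: "lead_coeff M = 1"
  obtains ls where "set ls \<subseteq> L" "M = (\<Prod>l\<leftarrow>ls. [:- l, 1:]) * rootfree_part L M"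
    "\<And>l. l \<in> L \<Longrightarrow> comaximal [:- l, 1:] (rootfree_part L M)"
proof -
  let ?ok = "\<lambda>Q. lead_coeff Q = 1 \<and> (\<forall>l\<in>L. poly Q l \<noteq> 0) \<and>
     (\<exists>ls. set ls \<subseteq> L \<and> M = (\<Prod>l\<leftarrow>ls. [:- l, 1:]) * Q)"
  have dvd: "Q dvd Q'" if "?ok Q" "?ok Q'" for Q Q'
  proof -
    obtain ls where ls: "set ls \<subseteq> L" "M = (\<Prod>l\<leftarrow>ls. [:- l, 1:]) * Q'" using \<open>?ok Q'\<close> by blast
    have "Q dvd M" using \<open>?ok Q\<close> by auto
    moreover have "comaximal (\<Prod>l\<leftarrow>ls. [:- l, 1:]) Q"
      using ls(1) \<open>?ok Q\<close> by (intro comaximal_prod_list) (auto intro!: comaximal_linear)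
    ultimately show ?thesis using comaximal_dvd_mult[OF comaximal_sym] ls(2) by blast
  qed
  obtain Q0 where Q0: "?ok Q0" using rootfree_decomposition_exists[OF M, of L] by blast
  have "?ok (rootfree_part L M)"
    unfolding rootfree_part_def
  proof (rule theI[of ?ok, OF Q0])
    fix Q assume Q: "?ok Q"
    show "Q = Q0" by (rule monic_dvd_antisym) (use Q Q0 dvd in blast)+
  qed
  then show ?thesis using that comaximal_linear by metis
qed

context endomorphism begin

text \<open>
  If every \<open>X - l\<close> divides \<open>Z\<close>, then \<open>Z\<^sup>N Q\<close> is a multiple of the minimal polynomial, with \<open>Q\<close> the
  root-free part and \<open>N\<close> the number of linear factors split off. The polynomial \<open>Z\<close> is left open because
  both the product of all four factors and its arrangement in terms of \<open>D\<close> are of use.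
\<close>
lemma reduced_space_eq:
  obtains Q N where "reduced_space scale u L = {x. Q \<cdot> x = 0}"
    "\<And>l. l \<in> L \<Longrightarrow> comaximal [:- l, 1:] Q"
    "\<And>Z x. (\<And>l. l \<in> L \<Longrightarrow> [:- l, 1:] dvd Z) \<Longrightarrow> (Z ^ N * Q) \<cdot> x = 0"
proof -
  let ?m = "minimal_polynomial scale u"
  let ?Q = "rootfree_part L ?m"
  have m: "is_min_poly UNIV ?m" by (rule minimal_polynomial_is_min_poly)
  then have lead: "lead_coeff ?m = 1" by (simp add: is_min_poly_def)
  obtain ls where ls: "set ls \<subseteq> L" "?m = (\<Prod>l\<leftarrow>ls. [:- l, 1:]) * ?Q"
    and co: "\<And>l. l \<in> L \<Longrightarrow> comaximal [:- l, 1:] ?Q" using rootfree_part_spec[OF lead, of L] by blast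
  show ?thesis
  proof (rule that[of ?Q "length ls"])
    show "reduced_space scale u L = {x. ?Q \<cdot> x = 0}" by (simp add: reduced_space_def)
    show "comaximal [:- l, 1:] ?Q" if "l \<in> L" for l using co that .
    fix Z x assume Z: "\<And>l. l \<in> L \<Longrightarrow> [:- l, 1:] dvd Z"
    have "(\<Prod>l\<leftarrow>ls'. [:- l, 1:]) dvd Z ^ length ls'" if "set ls' \<subseteq> L" for ls'
      using that Z by (induction ls') (simp_all add: mult_dvd_mono del: mult_pCons_left mult_pCons_right)
    then have "?m dvd Z ^ length ls * ?Q" using ls by (metis mult_dvd_mono dvd_refl)
    then show "(Z ^ length ls * ?Q) \<cdot> x = 0" using m unfolding is_min_poly_def by blast
  qed
qed

lemma kernel_mult:
  assumes "comaximal p q"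
  shows "{x. (p * q) \<cdot> x = 0} = span ({x. p \<cdot> x = 0} \<union> {x. q \<cdot> x = 0})"
proof
  show "span ({x. p \<cdot> x = 0} \<union> {x. q \<cdot> x = 0}) \<subseteq> {x. (p * q) \<cdot> x = 0}"
  proof (rule span_minimal)
    show "{x. p \<cdot> x = 0} \<union> {x. q \<cdot> x = 0} \<subseteq> {x. (p * q) \<cdot> x = 0}"
      unfolding act_mult by (auto, metis act_commute act_0_right)
  qed (rule subspace_act_kernel)
  obtain a b where ab: "a * p + b * q = 1" using assms comaximal_def by blast
  show "{x. (p * q) \<cdot> x = 0} \<subseteq> span ({x. p \<cdot> x = 0} \<union> {x. q \<cdot> x = 0})"
  proof
    fix x assume "x \<in> {x. (p * q) \<cdot> x = 0}"
    then have x: "p \<cdot> q \<cdot> x = 0" by (simp add: act_mult)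
    have "x = (a * p + b * q) \<cdot> x" using ab by simp
    also have "\<dots> = a \<cdot> p \<cdot> x + b \<cdot> q \<cdot> x" by (simp add: act_add act_mult)
    also have "\<dots> \<in> span ({x. p \<cdot> x = 0} \<union> {x. q \<cdot> x = 0})"
    proof (intro span_add span_base)
      have "q \<cdot> a \<cdot> p \<cdot> x = a \<cdot> p \<cdot> q \<cdot> x" by (metis act_commute)
      then show "a \<cdot> p \<cdot> x \<in> {x. p \<cdot> x = 0} \<union> {x. q \<cdot> x = 0}" using x by simp
      have "p \<cdot> b \<cdot> q \<cdot> x = b \<cdot> p \<cdot> q \<cdot> x" by (metis act_commute)
      then show "b \<cdot> q \<cdot> x \<in> {x. p \<cdot> x = 0} \<union> {x. q \<cdot> x = 0}" using x by simp
    qed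
    finally show "x \<in> span ({x. p \<cdot> x = 0} \<union> {x. q \<cdot> x = 0})" .
  qed
qed

lemma dim_kernel_mult:
  assumes "comaximal p q"
  shows "dim {x. (p * q) \<cdot> x = 0} = dim {x. p \<cdot> x = 0} + dim {x. q \<cdot> x = 0}"
  unfolding kernel_mult[OF assms]
  by (rule dim_direct_sum)
    (use act_comaximal_zero[OF assms] in \<open>auto simp: subspace_act_kernel\<close>)

text \<open>
  All kernels \<open>ker (u - c)\<^sup>k\<close> lie in the generalized eigenspace \<open>ker (u - c)\<^sup>N\<close>, so the jumps of \<open>u\<close> can be
  computed there.
\<close>
lemma kernel_jump_eq:
  assumes co: "comaximal [:- c, 1:] R" and kill: "\<And>x. ([:- c, 1:] ^ N * R) \<cdot> x = 0"
  shows "kernel_jump scale u c =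
    (\<lambda>k. kernel_dim {x. [:- c, 1:] ^ N \<cdot> x = 0} c k - kernel_dim {x. [:- c, 1:] ^ N \<cdot> x = 0} c (k - 1))"
proof -
  have "[:- c, 1:] ^ N \<cdot> x = 0" if "[:- c, 1:] ^ k \<cdot> x = 0" for k x
  proof (rule act_comaximal_zero[OF comaximal_power[OF co]])
    show "[:- c, 1:] ^ k \<cdot> [:- c, 1:] ^ N \<cdot> x = 0" using that by (metis act_commute act_0_right)
    show "R \<cdot> [:- c, 1:] ^ N \<cdot> x = 0" using kill[of x] by (simp only: act_mult act_commute[of R])
  qed
  then have "{x. [:- c, 1:] ^ N \<cdot> x = 0} \<inter> {x. [:- c, 1:] ^ k \<cdot> x = 0} = UNIV \<inter> {x. [:- c, 1:] ^ k \<cdot> x = 0}" for k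
    by blast
  then show ?thesis unfolding kernel_jump_kernel_dim[abs_def] kernel_dim_def by simp
qed

end

section \<open>Elementary factors as cyclic vectors\<close>

lemma sum_shift_upt: "(\<Sum>i<n + m. f i) = (\<Sum>i<n. f i) + (\<Sum>i<m. f (n + i))" for f :: "nat \<Rightarrow> 'a::comm_monoid_add"
  by (induction m) (simp_all add: add.assoc)

context endomorphism begin

definition krylov_list :: "'e \<Rightarrow> nat \<Rightarrow> 'e list" where
  "krylov_list x k = map (\<lambda>j. (u ^^ j) x) [0..<k]"

lemma span_krylov_list: "span (set (krylov_list x k)) = krylov x k"
  by (simp add: krylov_list_def krylov_def atLeast0LessThan)

text \<open>
  The matrix condition of \<^const>\<open>represents_on\<close> alone, separated from the condition that the list is a
  basis; in this form it can be treated block by block.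
\<close>
definition columns_match :: "'e list \<Rightarrow> 'k mat \<Rightarrow> bool" where
  "columns_match bs A \<longleftrightarrow> (\<forall>j<length bs. u (bs ! j) = (\<Sum>i<length bs. A $$ (i, j) *s (bs ! i)))"

lemma columns_match_four_block:
  assumes A: "A \<in> carrier_mat (length bs) (length bs)" and B: "B \<in> carrier_mat (length cs) (length cs)"
  shows "columns_match (bs @ cs) (four_block_mat A (0\<^sub>m (length bs) (length cs)) (0\<^sub>m (length cs) (length bs)) B)
    \<longleftrightarrow> columns_match bs A \<and> columns_match cs B"
proof -
  let ?M = "four_block_mat A (0\<^sub>m (length bs) (length cs)) (0\<^sub>m (length cs) (length bs)) B"
  have left: "(\<Sum>i<length (bs @ cs). ?M $$ (i, j) *s ((bs @ cs) ! i)) = (\<Sum>i<length bs. A $$ (i, j) *s (bs ! i))"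
    if "j < length bs" for j
    using A B that by (simp add: sum_shift_upt nth_append)
  have right: "(\<Sum>i<length (bs @ cs). ?M $$ (i, length bs + j) *s ((bs @ cs) ! i)) = (\<Sum>i<length cs. B $$ (i, j) *s (cs ! i))"
    if "j < length cs" for j
    using A B that by (simp add: sum_shift_upt nth_append)
  have split: "(\<forall>j<length (bs @ cs). R j) \<longleftrightarrow> (\<forall>j<length bs. R j) \<and> (\<forall>j<length cs. R (length bs + j))" for R
  proof (intro iffI conjI allI impI)
    fix j assume R: "(\<forall>j<length bs. R j) \<and> (\<forall>j<length cs. R (length bs + j))" and "j < length (bs @ cs)"
    then have "j < length bs \<or> j - length bs < length cs \<and> j = length bs + (j - length bs)" by auto
    then show "R j" using R by metis
  qed auto
  have "columns_match (bs @ cs) ?M \<longleftrightarrow>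
    (\<forall>j<length bs. u ((bs @ cs) ! j) = (\<Sum>i<length (bs @ cs). ?M $$ (i, j) *s ((bs @ cs) ! i))) \<and>
    (\<forall>j<length cs. u ((bs @ cs) ! (length bs + j)) = (\<Sum>i<length (bs @ cs). ?M $$ (i, length bs + j) *s ((bs @ cs) ! i)))"
    unfolding columns_match_def by (rule split)
  also have "\<dots> \<longleftrightarrow> columns_match bs A \<and> columns_match cs B"
    unfolding columns_match_def using left right by (simp add: nth_append)
  finally show ?thesis .
qed

text \<open>
  All columns of a companion matrix but the last say that the list consists of the iterates of its head;
  the last one says that \<open>P\<close> kills the head.
\<close>
lemma columns_match_companion:
  assumes P: "lead_coeff P = 1" "degree P > 0" and len: "length bs = degree P"
  shows "columns_match bs (companion_matrix P) \<longleftrightarrow> bs = krylov_list (hd bs) (degree P) \<and> P \<cdot> hd bs = 0"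
proof -
  define d where "d = degree P"
  have d: "d > 0" "length bs = d" using P len d_def by auto
  have hd: "hd bs = bs ! 0" using d by (metis hd_conv_nth length_0_conv less_irrefl)
  have col: "(\<Sum>i<d. companion_matrix P $$ (i, j) *s (bs ! i)) = bs ! Suc j" if "Suc j < d" for j
  proof -
    have "(\<Sum>i<d. companion_matrix P $$ (i, j) *s (bs ! i)) = (\<Sum>i<d. if i = Suc j then bs ! i else 0)"
      by (rule sum.cong) (use that d_def in \<open>auto simp: companion_matrix_def\<close>)
    then show ?thesis using that by simp
  qed
  have last: "(\<Sum>i<d. companion_matrix P $$ (i, d - 1) *s (bs ! i)) = - (\<Sum>i<d. coeff P i *s (bs ! i))"
    unfolding sum_negf[symmetric]
    by (rule sum.cong) (use d d_def in \<open>auto simp: companion_matrix_def\<close>)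
  have "columns_match bs (companion_matrix P) \<longleftrightarrow>
     (\<forall>j. Suc j < d \<longrightarrow> u (bs ! j) = bs ! Suc j) \<and> u (bs ! (d - 1)) = - (\<Sum>i<d. coeff P i *s (bs ! i))" (is "_ \<longleftrightarrow> ?R")
  proof
    assume "columns_match bs (companion_matrix P)"
    then have *: "u (bs ! j) = (\<Sum>i<d. companion_matrix P $$ (i, j) *s (bs ! i))" if "j < d" for j
      using that d by (simp add: columns_match_def)
    show ?R using * col last d(1) by simp
  next
    assume R: ?R
    show "columns_match bs (companion_matrix P)"
      unfolding columns_match_def d(2)
    proof (intro allI impI)
      fix j assume "j < d"
      then consider "Suc j < d" | "j = d - 1" by linarith
      then show "u (bs ! j) = (\<Sum>i<d. companion_matrix P $$ (i, j) *s (bs ! i))"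
        by cases (use R col last in simp_all)
    qed
  qed
  also have "\<dots> \<longleftrightarrow> (\<forall>j<d. bs ! j = (u ^^ j) (bs ! 0)) \<and> P \<cdot> (bs ! 0) = 0"
  proof -
    have pow: "(\<forall>j. Suc j < d \<longrightarrow> u (bs ! j) = bs ! Suc j) \<longleftrightarrow> (\<forall>j<d. bs ! j = (u ^^ j) (bs ! 0))"
    proof
      assume step: "\<forall>j. Suc j < d \<longrightarrow> u (bs ! j) = bs ! Suc j"
      have "j < d \<Longrightarrow> bs ! j = (u ^^ j) (bs ! 0)" for j
        by (induction j) (use step in auto)
      then show "\<forall>j<d. bs ! j = (u ^^ j) (bs ! 0)" by blast
    qed (metis Suc_lessD comp_apply funpow.simps(2))
    have "P \<cdot> (bs ! 0) = 0 \<longleftrightarrow> u (bs ! (d - 1)) = - (\<Sum>i<d. coeff P i *s (bs ! i))"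
      if pw: "\<forall>j<d. bs ! j = (u ^^ j) (bs ! 0)"
    proof -
      have "P \<cdot> (bs ! 0) = (\<Sum>i<d. coeff P i *s (u ^^ i) (bs ! 0)) + (u ^^ d) (bs ! 0)"
        using P(1) unfolding poly_endo_def d_def by (simp add: lessThan_Suc_atMost[symmetric])
      also have "(\<Sum>i<d. coeff P i *s (u ^^ i) (bs ! 0)) = (\<Sum>i<d. coeff P i *s (bs ! i))"
        by (rule sum.cong[OF refl]) (metis pw lessThan_iff)
      also have "(u ^^ d) (bs ! 0) = u (bs ! (d - 1))"
      proof -
        obtain e where e: "d = Suc e" using d(1) gr0_implies_Suc by blast
        then have "bs ! e = (u ^^ e) (bs ! 0)" using pw by blast
        then have "u (bs ! e) = u ((u ^^ e) (bs ! 0))" by (rule arg_cong)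
        then show ?thesis unfolding e by (simp only: funpow.simps comp_apply diff_Suc_1)
      qed
      finally show ?thesis by (simp add: eq_neg_iff_add_eq_0 add.commute)
    qed
    then show ?thesis using pow by blast
  qed
  also have "\<dots> \<longleftrightarrow> bs = krylov_list (hd bs) (degree P) \<and> P \<cdot> hd bs = 0"
    using d by (auto simp: krylov_list_def hd d_def[symmetric] list_eq_iff_nth_eq)
  finally show ?thesis .
qed

lemma companion_carrier: "companion_matrix P \<in> carrier_mat (degree P) (degree P)"
  by (simp add: companion_matrix_def)

lemma diag_companion_carrier:
  "diag_block_mat (map companion_matrix Ps) \<in> carrier_mat (sum_list (map degree Ps)) (sum_list (map degree Ps))"
proof -
  have "map dim_row (map companion_matrix Ps) = map degree Ps"
    "map dim_col (map companion_matrix Ps) = map degree Ps" by (simp_all add: companion_matrix_def)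
  then show ?thesis by (intro carrier_matI) (simp_all only: dim_diag_block_mat)
qed

lemma columns_match_diag_companion_Cons:
  assumes "length bs = degree P" "length cs = sum_list (map degree Ps)"
  shows "columns_match (bs @ cs) (diag_block_mat (map companion_matrix (P # Ps))) \<longleftrightarrow>
    columns_match bs (companion_matrix P) \<and> columns_match cs (diag_block_mat (map companion_matrix Ps))"
proof -
  have "companion_matrix P \<in> carrier_mat (length bs) (length bs)"
    "diag_block_mat (map companion_matrix Ps) \<in> carrier_mat (length cs) (length cs)"
    using assms companion_carrier diag_companion_carrier by metis+
  then show ?thesis using columns_match_four_block[of "companion_matrix P" bs "diag_block_mat (map companion_matrix Ps)" cs]
    by (simp add: Let_def)
qed

definition krylov_blocks :: "('e \<times> 'k poly) list \<Rightarrow> 'e list" where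
  "krylov_blocks L = concat (map (\<lambda>(x, P). krylov_list x (degree P)) L)"

lemma length_krylov_blocks: "length (krylov_blocks L) = sum_list (map degree (map snd L))"
  by (induction L) (auto simp: krylov_blocks_def krylov_list_def)

lemma span_krylov_blocks: "span (set (krylov_blocks L)) = span (\<Union>(x, P)\<in>set L. krylov x (degree P))"
proof (induction L)
  case Nil then show ?case by (simp add: krylov_blocks_def)
next
  case (Cons a L)
  obtain x P where a: "a = (x, P)" by fastforce
  have "span (set (krylov_blocks (a # L))) = span (set (krylov_list x (degree P)) \<union> set (krylov_blocks L))"
    by (simp add: krylov_blocks_def a)
  also have "\<dots> = span (krylov x (degree P) \<union> (\<Union>(x, P)\<in>set L. krylov x (degree P)))"
    unfolding span_Un span_krylov_list Cons krylov_def span_span ..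
  finally show ?case by (simp add: a)
qed

lemma columns_match_krylov_blocks:
  assumes "\<And>x P. (x, P) \<in> set L \<Longrightarrow> lead_coeff P = 1 \<and> degree P > 0 \<and> P \<cdot> x = 0"
  shows "columns_match (krylov_blocks L) (diag_block_mat (map companion_matrix (map snd L)))"
  using assms
proof (induction L)
  case Nil then show ?case by (simp add: krylov_blocks_def columns_match_def)
next
  case (Cons a L)
  obtain x P where a: "a = (x, P)" by fastforce
  have P: "lead_coeff P = 1" "degree P > 0" "P \<cdot> x = 0" using Cons.prems[of x P] a by auto
  have len: "length (krylov_list x (degree P)) = degree P" by (simp add: krylov_list_def)
  have hd: "hd (krylov_list x (degree P)) = x" using P(2) by (simp add: krylov_list_def hd_map)
  have "columns_match (krylov_list x (degree P)) (companion_matrix P)"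
    using columns_match_companion[OF P(1,2) len] hd P(3) by simp
  moreover have "columns_match (krylov_blocks L) (diag_block_mat (map companion_matrix (map snd L)))"
    using Cons by (meson list.set_intros(2))
  ultimately have "columns_match (krylov_list x (degree P) @ krylov_blocks L)
      (diag_block_mat (map companion_matrix (P # map snd L)))"
    using columns_match_diag_companion_Cons[OF len length_krylov_blocks] by blast
  then show ?case by (simp add: a krylov_blocks_def)
qed

lemma krylov_blocks_if_columns_match:
  assumes "\<And>P. P \<in> set Ps \<Longrightarrow> lead_coeff P = 1 \<and> degree P > 0"
    and "columns_match bs (diag_block_mat (map companion_matrix Ps))"
    and "length bs = sum_list (map degree Ps)"
  shows "\<exists>L. map snd L = Ps \<and> bs = krylov_blocks L \<and> (\<forall>(x, P)\<in>set L. P \<cdot> x = 0)"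
  using assms
proof (induction Ps arbitrary: bs)
  case Nil
  then show ?case by (intro exI[of _ "[]"]) (simp add: krylov_blocks_def)
next
  case (Cons P Ps)
  let ?b = "take (degree P) bs" and ?c = "drop (degree P) bs"
  have len: "length ?b = degree P" "length ?c = sum_list (map degree Ps)" using Cons.prems(3) by simp_all
  have P: "lead_coeff P = 1" "degree P > 0" using Cons.prems(1) by auto
  have "columns_match (?b @ ?c) (diag_block_mat (map companion_matrix (P # Ps)))"
    using Cons.prems(2) by simp
  then have 1: "columns_match ?b (companion_matrix P)"
    and 2: "columns_match ?c (diag_block_mat (map companion_matrix Ps))"
    using columns_match_diag_companion_Cons[OF len] by blast+
  obtain L where L: "map snd L = Ps" "?c = krylov_blocks L" "\<forall>(x, P)\<in>set L. P \<cdot> x = 0"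
    using Cons.IH[OF _ 2 len(2)] Cons.prems(1) by auto
  have b: "?b = krylov_list (hd ?b) (degree P)" "P \<cdot> hd ?b = 0"
    using columns_match_companion[OF P len(1)] 1 by blast+
  have "bs = krylov_list (hd ?b) (degree P) @ krylov_blocks L"
    using b(1) L(2) by (metis append_take_drop_id)
  then show ?case
    using L b(2) by (intro exI[of _ "(hd ?b, P) # L"]) (simp add: krylov_blocks_def)
qed

text \<open>
  Elementary factors in terms of vectors: the Krylov bases generate \<open>V\<close>, and the degrees add up to the
  dimension, which accounts for distinctness and independence of the basis.
\<close>
lemma elementary_factors_iff:
  assumes "subspace V"
  shows "elementary_factors scale V u Ps \<longleftrightarrow> (\<forall>P\<in>set Ps. lead_coeff P = 1 \<and> degree P > 0) \<and>
    sorted_wrt (dvd) Ps \<and> (\<exists>L. map snd L = Ps \<and> (\<forall>(x, P)\<in>set L. P \<cdot> x = 0) \<and>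
      V = span (\<Union>(x, P)\<in>set L. krylov x (degree P)) \<and> sum_list (map degree Ps) = dim V)"
    (is "_ \<longleftrightarrow> ?monic \<and> ?sorted \<and> ?ex")
proof -
  have "?monic \<Longrightarrow> (\<exists>bs. represents_on scale V u bs (diag_block_mat (map companion_matrix Ps))) \<longleftrightarrow> ?ex"
  proof
    assume monic: ?monic and "\<exists>bs. represents_on scale V u bs (diag_block_mat (map companion_matrix Ps))"
    then obtain bs where bs: "distinct bs" "independent (set bs)" "span (set bs) = V"
      "diag_block_mat (map companion_matrix Ps) \<in> carrier_mat (length bs) (length bs)"
      "columns_match bs (diag_block_mat (map companion_matrix Ps))"
      unfolding represents_on_def columns_match_def by blast
    have len: "length bs = sum_list (map degree Ps)"
      using bs(4) diag_companion_carrier[of Ps] by (metis carrier_matD(1))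
    obtain L where L: "map snd L = Ps" "bs = krylov_blocks L" "\<forall>(x, P)\<in>set L. P \<cdot> x = 0"
      using krylov_blocks_if_columns_match[OF _ bs(5) len] monic by blast
    have "dim V = card (set bs)" using dim_span_eq_card_independent[OF bs(2)] bs(3) by simp
    then have "sum_list (map degree Ps) = dim V" using len bs(1) by (simp add: distinct_card)
    then show ?ex using L bs(3) span_krylov_blocks[of L] by blast
  next
    assume monic: ?monic and ?ex
    then obtain L where L: "map snd L = Ps" "\<forall>(x, P)\<in>set L. P \<cdot> x = 0"
      "V = span (\<Union>(x, P)\<in>set L. krylov x (degree P))" "sum_list (map degree Ps) = dim V" by blast
    let ?bs = "krylov_blocks L"
    have len: "length ?bs = dim V" using L(1,4) length_krylov_blocks[of L] by metis
    have span: "span (set ?bs) = V" using L(3) span_krylov_blocks by simp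
    have "dim V \<le> card (set ?bs)" by (rule dim_le_card) (use span in auto)
    then have card: "card (set ?bs) = length ?bs" using card_length[of ?bs] len by simp
    have sub: "set ?bs \<subseteq> V" using span span_superset by blast
    have "independent (set ?bs)"
      using card_le_dim_spanning[OF sub] span card len by auto
    moreover have "columns_match ?bs (diag_block_mat (map companion_matrix Ps))"
      using columns_match_krylov_blocks[of L] L(1,2) monic by force
    moreover have "diag_block_mat (map companion_matrix Ps) \<in> carrier_mat (length ?bs) (length ?bs)"
      using diag_companion_carrier[of Ps] len L(4) by simp
    ultimately show "\<exists>bs. represents_on scale V u bs (diag_block_mat (map companion_matrix Ps))"
      using span card_distinct[OF card] unfolding represents_on_def columns_match_def by blast
  qed
  then show ?thesis unfolding elementary_factors_def by blast
qed

section \<open>The conditions are sufficient\<close>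

text \<open>
  The relation \<open>S(C) z = 0\<close> with \<open>S\<close> monic expresses \<open>C\<^sup>a z\<close>, for \<open>a = degree S\<close>, through lower powers,
  which closes the alternating chain of \<open>z\<close>.
\<close>
lemma alternating_cyclic_pcompose:
  assumes P: "P = pcompose S ([:- d, 1:] * [:- c, 1:])" and "lead_coeff P = 1" and "P \<cdot> z = 0"
  shows "alternating c d (cyclic z) (degree P)"
proof -
  define C where "C = [:- d, 1:] * [:- c, 1:]"
  have dC: "degree C = 2" and lC: "lead_coeff C = 1" unfolding C_def by simp_all
  have lS: "lead_coeff S = 1"
    using assms(1,2) lead_coeff_comp[of C S] dC lC by (simp add: C_def)
  let ?a = "degree S"
  have "C ^ ?a \<cdot> z \<in> span ((\<lambda>j. C ^ j \<cdot> z) ` {..<?a})"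
  proof -
    have "0 = (\<Sum>i\<le>?a. coeff S i *s (C ^ i \<cdot> z))"
      using assms(3) unfolding P C_def[symmetric] act_pcompose act_power by (simp add: poly_endo_def)
    also have "\<dots> = (\<Sum>i<?a. coeff S i *s (C ^ i \<cdot> z)) + C ^ ?a \<cdot> z"
      using lS by (simp add: lessThan_Suc_atMost[symmetric])
    finally have "C ^ ?a \<cdot> z = - (\<Sum>i<?a. coeff S i *s (C ^ i \<cdot> z))"
      by (metis neg_eq_iff_add_eq_0 add.commute minus_minus)
    then show ?thesis by (simp only:) (intro span_neg span_sum span_scale span_base, blast)
  qed
  then have "alternating c d (cyclic z) (?a + ?a)"
    unfolding C_def by (intro alternating_cyclic) blast
  moreover have "degree P = ?a + ?a" unfolding P C_def[symmetric] degree_pcompose dC by simp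
  ultimately show ?thesis by simp
qed

lemma alternating_if_elementary_factors:
  assumes "subspace V" "elementary_factors scale V u Ps"
    and "\<And>P. P \<in> set Ps \<Longrightarrow> \<exists>S. P = pcompose S ([:- d, 1:] * [:- c, 1:])"
  shows "alternating c d V (dim V)"
proof -
  obtain L where L: "map snd L = Ps" "\<forall>(x, P)\<in>set L. P \<cdot> x = 0"
      "V = span (\<Union>(x, P)\<in>set L. krylov x (degree P))" "sum_list (map degree Ps) = dim V"
    and monic: "\<forall>P\<in>set Ps. lead_coeff P = 1 \<and> degree P > 0"
    using assms(2) elementary_factors_iff[OF assms(1)] by blast
  have "alternating c d (span (\<Union>(x, P)\<in>set L'. krylov x (degree P))) (sum_list (map degree (map snd L')))"
    if "set L' \<subseteq> set L" for L'
    using that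
  proof (induction L')
    case Nil then show ?case using alternating_zero by simp
  next
    case (Cons a L')
    obtain x P where a: "a = (x, P)" by fastforce
    then have "(x, P) \<in> set L" using Cons.prems by simp
    then have P: "P \<in> set Ps" "P \<cdot> x = 0" using L(1,2) by force+
    then have lead: "lead_coeff P = 1" and "P \<noteq> 0" using monic by auto
    obtain S where S: "P = pcompose S ([:- d, 1:] * [:- c, 1:])" using assms(3)[OF P(1)] by blast
    have "alternating c d (krylov x (degree P)) (degree P)"
      using alternating_cyclic_pcompose[OF S lead P(2)] cyclic_eq_krylov[OF P(2) \<open>P \<noteq> 0\<close>] by simp
    from alternating_Un[OF this Cons.IH] Cons.prems
    have "alternating c d (span (krylov x (degree P) \<union> span (\<Union>(x, P)\<in>set L'. krylov x (degree P))))
       (degree P + sum_list (map degree (map snd L')))" by simp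
    moreover have "span (krylov x (degree P) \<union> span (\<Union>(x, P)\<in>set L'. krylov x (degree P)))
       = span (\<Union>(x, P)\<in>set (a # L'). krylov x (degree P))"
      by (simp add: a span_Un span_span)
    ultimately show ?case by (simp add: a)
  qed
  from this[of L] show ?thesis using L(1,3,4) by simp
qed

text \<open>
  The space is the direct sum of the generalized eigenspaces of the four exceptional scalars and the
  reduced space. The reduced space alternates in the same way as the pair \<open>0, \<alpha> + \<beta>\<close>, so it joins the part
  on which \<open>u\<close> and \<open>u - (\<alpha> + \<beta>)\<close> alternate. In \<open>[:- 0, 1:]\<close> the zero is kept to match the general form
  \<open>[:- c, 1:]\<close>.
\<close>
lemma composite_if_conditions:
  assumes nz: "\<alpha> \<noteq> 0" "\<beta> \<noteq> 0" "\<alpha> \<noteq> \<beta>" "\<alpha> \<noteq> - \<beta>"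
    and int1: "intertwined (kernel_jump scale u 0) (kernel_jump scale u (\<alpha> + \<beta>))"
    and int2: "intertwined (kernel_jump scale u \<alpha>) (kernel_jump scale u \<beta>)"
    and el: "elementary_factors scale (reduced_space scale u {0, \<alpha>, \<beta>, \<alpha> + \<beta>}) u Ps"
    and poly: "\<And>P. P \<in> set Ps \<Longrightarrow> \<exists>S. P = pcompose S ([:- (\<alpha> + \<beta>), 1:] * [:- 0, 1:])"
  shows "composite scale \<alpha> \<beta> u"
proof -
  have s0: "\<alpha> + \<beta> \<noteq> 0" using nz by (simp add: eq_neg_iff_add_eq_0)
  define l where "l c = [:- c, 1:]" for c :: 'k
  obtain Q N where Q: "reduced_space scale u {0, \<alpha>, \<beta>, \<alpha> + \<beta>} = {x. Q \<cdot> x = 0}"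
    and co: "\<And>c. c \<in> {0, \<alpha>, \<beta>, \<alpha> + \<beta>} \<Longrightarrow> comaximal (l c) Q"
    and kill: "\<And>Z x. (\<And>c. c \<in> {0, \<alpha>, \<beta>, \<alpha> + \<beta>} \<Longrightarrow> l c dvd Z) \<Longrightarrow> (Z ^ N * Q) \<cdot> x = 0"
    by (rule reduced_space_eq[of "{0, \<alpha>, \<beta>, \<alpha> + \<beta>}"]) (auto simp: l_def)
  define V where "V c = {x. l c ^ N \<cdot> x = 0}" for c
  define E where "E = {x. Q \<cdot> x = 0}"
  have col: "comaximal (l c) (l d)" if "c \<noteq> d" for c d
    unfolding l_def using comaximal_linear_powers[OF that, of 1 1] by simp
  have coN: "comaximal (l c ^ N) (l d ^ N)" if "c \<noteq> d" for c d
    unfolding l_def using comaximal_linear_powers[OF that] .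
  have coQ: "comaximal (l c ^ N) Q" if "c \<in> {0, \<alpha>, \<beta>, \<alpha> + \<beta>}" for c
    using co[OF that] by (rule comaximal_power)
  let ?F1 = "l 0 ^ N * l (\<alpha> + \<beta>) ^ N" and ?F2 = "l \<alpha> ^ N * l \<beta> ^ N"
  have all: "((?F1 * Q) * ?F2) \<cdot> x = 0" for x
  proof -
    have "((l 0 * l (\<alpha> + \<beta>) * l \<alpha> * l \<beta>) ^ N * Q) \<cdot> x = 0"
      by (rule kill) (auto intro: dvd_mult dvd_mult2)
    then show ?thesis by (simp only: power_mult_distrib ac_simps)
  qed
  have jump: "kernel_jump scale u c = (\<lambda>k. kernel_dim (V c) c k - kernel_dim (V c) c (k - 1))"
    if "comaximal (l c) R" "\<And>x. (l c ^ N * R) \<cdot> x = 0" for c R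
    using kernel_jump_eq[of c R N] that unfolding l_def V_def by blast
  have c0: "comaximal (l 0) (l (\<alpha> + \<beta>) ^ N * Q * ?F2)"
    and cs: "comaximal (l (\<alpha> + \<beta>)) (l 0 ^ N * Q * ?F2)"
    and ca: "comaximal (l \<alpha>) (?F1 * Q * l \<beta> ^ N)"
    and cb: "comaximal (l \<beta>) (?F1 * Q * l \<alpha> ^ N)"
    by (rule comaximal_sym, (intro comaximal_mult comaximal_power; (rule col | rule comaximal_sym[OF co]));
        use nz s0 in auto)+
  have stV: "stable (V c)" for c unfolding V_def by (rule stable_kernel)
  have j0: "kernel_jump scale u 0 = (\<lambda>k. kernel_dim (V 0) 0 k - kernel_dim (V 0) 0 (k - 1))"
    by (rule jump[OF c0]) (use all in \<open>simp only: ac_simps\<close>)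
  have js: "kernel_jump scale u (\<alpha> + \<beta>) = (\<lambda>k. kernel_dim (V (\<alpha> + \<beta>)) (\<alpha> + \<beta>) k - kernel_dim (V (\<alpha> + \<beta>)) (\<alpha> + \<beta>) (k - 1))"
    by (rule jump[OF cs]) (use all in \<open>simp only: ac_simps\<close>)
  have ja: "kernel_jump scale u \<alpha> = (\<lambda>k. kernel_dim (V \<alpha>) \<alpha> k - kernel_dim (V \<alpha>) \<alpha> (k - 1))"
    by (rule jump[OF ca]) (use all in \<open>simp only: ac_simps\<close>)
  have jb: "kernel_jump scale u \<beta> = (\<lambda>k. kernel_dim (V \<beta>) \<beta> k - kernel_dim (V \<beta>) \<beta> (k - 1))"
    by (rule jump[OF cb]) (use all in \<open>simp only: ac_simps\<close>)
  have alt1: "alternating 0 (\<alpha> + \<beta>) (span (V 0 \<union> V (\<alpha> + \<beta>))) (dim (V 0) + dim (V (\<alpha> + \<beta>)))"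
    by (rule alternating_if_intertwined[OF s0[symmetric] stV stV _ _ int1[unfolded j0 js], where N = N and M = N])
      (simp_all only: V_def l_def mem_Collect_eq)
  have alt2: "alternating \<alpha> \<beta> (span (V \<alpha> \<union> V \<beta>)) (dim (V \<alpha>) + dim (V \<beta>))"
    by (rule alternating_if_intertwined[OF nz(3) stV stV _ _ int2[unfolded ja jb], where N = N and M = N])
      (simp_all only: V_def l_def mem_Collect_eq)
  have "alternating 0 (\<alpha> + \<beta>) E (dim E)"
    by (rule alternating_if_elementary_factors[OF _ el[unfolded Q, folded E_def] poly])
      (auto simp: E_def subspace_act_kernel)
  from alternating_Un[OF alt1 this]
  have alt1': "alternating 0 (\<alpha> + \<beta>) (span (span (V 0 \<union> V (\<alpha> + \<beta>)) \<union> E)) (dim (V 0) + dim (V (\<alpha> + \<beta>)) + dim E)" .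
  have co1: "comaximal (l 0 ^ N) (l (\<alpha> + \<beta>) ^ N)" by (rule coN) (use s0 in simp)
  have co2: "comaximal ?F1 Q" by (intro comaximal_mult coQ) auto
  have co3: "comaximal (l \<alpha> ^ N) (l \<beta> ^ N)" by (rule coN) (use nz in simp)
  have co4: "comaximal (?F1 * Q) ?F2"
  proof (rule comaximal_sym, rule comaximal_mult; rule comaximal_sym)
    show "comaximal (?F1 * Q) (l \<alpha> ^ N)"
      by (rule comaximal_mult[OF comaximal_mult[OF coN coN] comaximal_sym[OF coQ]]) (use nz in auto)
    show "comaximal (?F1 * Q) (l \<beta> ^ N)"
      by (rule comaximal_mult[OF comaximal_mult[OF coN coN] comaximal_sym[OF coQ]]) (use nz in auto)
  qed
  have full: "UNIV = {x. ((?F1 * Q) * ?F2) \<cdot> x = 0}" using all by blast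
  have "span (span (span (V 0 \<union> V (\<alpha> + \<beta>)) \<union> E) \<union> span (V \<alpha> \<union> V \<beta>)) = UNIV"
    unfolding V_def E_def kernel_mult[OF co1, symmetric] kernel_mult[OF co2, symmetric]
      kernel_mult[OF co3, symmetric] kernel_mult[OF co4, symmetric] using full by simp
  moreover have "dim UNIV = dim (V 0) + dim (V (\<alpha> + \<beta>)) + dim E + (dim (V \<alpha>) + dim (V \<beta>))"
    using arg_cong[OF full, of dim] unfolding V_def E_def dim_kernel_mult[OF co4] dim_kernel_mult[OF co3]
      dim_kernel_mult[OF co2] dim_kernel_mult[OF co1] .
  ultimately show ?thesis
    using composite_if_alternating[OF alt1' alt2 _ _ nz(1,2)] by simp
qed

section \<open>The conditions are necessary\<close>

lemma act_eigenvector: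
  assumes "[:- c, 1:] \<cdot> y = 0" shows "r \<cdot> y = poly r c *s y"
proof (induction r)
  case 0 then show ?case by simp
next
  case (pCons a r)
  have "u y = c *s y" using assms by (simp add: act_linear_factor)
  then show ?case using pCons by (simp add: act_pCons act_scale_right scale_left_distrib)
qed

text \<open>
  Let \<open>U = u - c\<close> and \<open>W = u - d\<close>. Up to sign \<open>g\<close> turns \<open>U\<close> into \<open>W\<close> and conversely, and \<open>g\<^sup>2 = U r(u)\<close> where
  \<open>r(u)\<close> acts on \<open>ker U\<close> as the nonzero scalar \<open>r(c)\<close>: so \<open>g\<close> is half a step of \<open>U\<close>. Accordingly
  the kernel of \<open>g U\<^sup>k\<close> on \<open>ker U\<^sup>k\<^sup>+\<^sup>1\<close> is put between \<open>ker U\<^sup>k\<close> and \<open>ker U\<^sup>k\<^sup>+\<^sup>1\<close>, and similarly for \<open>W\<close>. Each half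
  of the jump \<open>ker U\<^sup>k\<^sup>+\<^sup>1 / ker U\<^sup>k\<close> embeds into one half of \<open>ker W\<^sup>k / ker W\<^sup>k\<^sup>-\<^sup>1\<close>: the upper half by
  \<open>g\<^sup>3\<close> into the lower one, the lower half by \<open>g\<close> into the upper one.
\<close>
lemma kernel_jump_le:
  assumes g: "Vector_Spaces.linear scale scale g"
    and gc: "\<And>x. g ([:- c, 1:] \<cdot> x) = - ([:- d, 1:] \<cdot> g x)"
    and gd: "\<And>x. g ([:- d, 1:] \<cdot> x) = - ([:- c, 1:] \<cdot> g x)"
    and gg: "\<And>x. g (g x) = ([:- c, 1:] * r) \<cdot> x" and r: "poly r c \<noteq> 0" and k: "k \<ge> 1"
  shows "kernel_jump scale u c (k + 1) \<le> kernel_jump scale u d k"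
proof -
  interpret g: Vector_Spaces.linear scale scale g by (rule g)
  define U W where "U = [:- c, 1:]" and "W = [:- d, 1:]"
  obtain h where h: "k = Suc h" using k by (metis Suc_le_D One_nat_def)
  have gU: "W ^ j \<cdot> g x = (- 1) ^ j *s g (U ^ j \<cdot> x)" for j x
  proof (induction j)
    case 0 show ?case by simp
  next
    case (Suc j)
    have "W ^ Suc j \<cdot> g x = (- 1) ^ j *s (W \<cdot> g (U ^ j \<cdot> x))"
      by (simp add: act_mult Suc act_scale_right)
    also have "W \<cdot> g (U ^ j \<cdot> x) = - g (U ^ Suc j \<cdot> x)"
      by (simp add: act_mult gc[folded U_def W_def])
    finally show ?case by simp
  qed
  have sgn: "(- 1 :: 'k) ^ j \<noteq> 0" for j by simp
  have zero_iff: "W ^ j \<cdot> g x = 0 \<longleftrightarrow> g (U ^ j \<cdot> x) = 0" for j x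
    using gU[of j x] sgn[of j] by simp
  have g_zero_iff: "g (W ^ j \<cdot> g x) = 0 \<longleftrightarrow> g (g (U ^ j \<cdot> x)) = 0" for j x
    using gU[of j x] sgn[of j] by (simp add: g.scale)
  have gg': "g (g x) = r \<cdot> U \<cdot> x" for x
    using gg[of x] by (simp only: U_def act_mult act_commute[of r])
  have eig: "r \<cdot> U ^ k \<cdot> x = poly r c *s (U ^ k \<cdot> x)" if "U ^ Suc k \<cdot> x = 0" for x
    using act_eigenvector[of c "U ^ k \<cdot> x" r] that by (simp only: power_Suc act_mult U_def)
  have UU: "U \<cdot> U ^ h \<cdot> x = U ^ k \<cdot> x" "U ^ h \<cdot> U \<cdot> x = U ^ k \<cdot> x" for x
    by (simp_all add: h act_mult[symmetric] mult.commute)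
  define X where "X = {x. U ^ Suc k \<cdot> x = 0}"
  define X1 where "X1 = {x. U ^ Suc k \<cdot> x = 0 \<and> g (U ^ k \<cdot> x) = 0}"
  define X2 where "X2 = {x. U ^ k \<cdot> x = 0}"
  define Y where "Y = {y. W ^ k \<cdot> y = 0}"
  define Y1 where "Y1 = {y. W ^ k \<cdot> y = 0 \<and> g (W ^ h \<cdot> y) = 0}"
  define Y2 where "Y2 = {y. W ^ h \<cdot> y = 0}"
  have sub: "subspace X" "subspace X2" "subspace Y" "subspace Y2"
    unfolding X_def X2_def Y_def Y2_def by (rule subspace_act_kernel)+
  have sub1: "subspace X1" "subspace Y1"
    unfolding X1_def Y1_def
    by (rule subspaceI; simp add: act_add_right act_scale_right g.add g.scale)+
  \<comment> \<open>\<open>g\<^sup>3\<close> embeds \<open>X / X1\<close> into \<open>Y1 / Y2\<close>\<close>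
  have "dim X + dim Y2 \<le> dim Y1 + dim X1"
  proof (rule dim_quotient_injection[where f = "\<lambda>x. g (g (g x))"])
    show "Vector_Spaces.linear scale scale (\<lambda>x. g (g (g x)))"
      using Vector_Spaces.linear_compose[OF g Vector_Spaces.linear_compose[OF g g]] by (simp add: comp_def)
    show "subspace X" "subspace X1" "X1 \<subseteq> X" "subspace Y2"
      using sub sub1 by (auto simp: X1_def X_def)
    show "Y2 \<subseteq> Y1" by (auto simp: Y2_def Y1_def h act_mult)
    fix x assume x: "x \<in> X"
    then have x0: "U \<cdot> U ^ k \<cdot> x = 0" by (simp add: X_def act_mult)
    have ggg: "g (g (g x)) = g (r \<cdot> U \<cdot> x)" by (simp add: gg')
    have "U ^ k \<cdot> r \<cdot> U \<cdot> x = r \<cdot> U \<cdot> U ^ k \<cdot> x"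
      by (simp only: act_commute[of "U ^ k"])
    then have "W ^ k \<cdot> g (g (g x)) = 0" using x0 unfolding ggg zero_iff by simp
    moreover have Uh: "U ^ h \<cdot> r \<cdot> U \<cdot> x = r \<cdot> U ^ k \<cdot> x"
      by (simp only: act_commute[of "U ^ h" r] UU(2))
    have "U \<cdot> r \<cdot> U ^ k \<cdot> x = r \<cdot> U \<cdot> U ^ k \<cdot> x" by (rule act_commute)
    then have "g (g (U ^ h \<cdot> r \<cdot> U \<cdot> x)) = 0" unfolding Uh gg' x0 by (simp only: act_0_right)
    then have "g (W ^ h \<cdot> g (g (g x))) = 0" unfolding ggg g_zero_iff .
    ultimately show "g (g (g x)) \<in> Y1" by (simp add: Y1_def)
    assume "g (g (g x)) \<in> Y2"
    then have "g (r \<cdot> U ^ k \<cdot> x) = 0" by (simp add: Y2_def ggg zero_iff Uh)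
    then show "x \<in> X1" using x r eig by (simp add: X_def X1_def g.scale)
  qed
  \<comment> \<open>\<open>g\<close> embeds \<open>X1 / X2\<close> into \<open>Y / Y1\<close>\<close>
  moreover have "dim X1 + dim Y1 \<le> dim Y + dim X2"
  proof (rule dim_quotient_injection[OF g])
    show "subspace X1" "subspace X2" "subspace Y1" "Y1 \<subseteq> Y"
      using sub sub1 by (auto simp: Y1_def Y_def)
    show "X2 \<subseteq> X1" by (auto simp: X2_def X1_def act_mult g.zero)
    fix x assume x: "x \<in> X1"
    show "g x \<in> Y" using x by (simp add: X1_def Y_def zero_iff)
    assume "g x \<in> Y1"
    then have "g (g (U ^ h \<cdot> x)) = 0" by (simp add: Y1_def g_zero_iff)
    then have "r \<cdot> U ^ k \<cdot> x = 0" by (simp add: gg' UU(1))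
    then show "x \<in> X2" using x r eig by (simp add: X1_def X2_def)
  qed
  ultimately have "dim X + dim Y2 \<le> dim Y + dim X2" by simp
  then have "kernel_dim UNIV c (k + 1) + kernel_dim UNIV d (k - 1) \<le> kernel_dim UNIV d k + kernel_dim UNIV c k"
    unfolding kernel_dim_UNIV U_def[symmetric] W_def[symmetric] X_def Y2_def Y_def X2_def h by simp
  then show ?thesis unfolding kernel_jump_kernel_dim by simp
qed

end

locale idempotent_combination = endomorphism scale Basis u
  for scale :: "'k::field \<Rightarrow> 'e::ab_group_add \<Rightarrow> 'e" (infixr "*s" 75) and Basis u +
  fixes p q :: "'e \<Rightarrow> 'e" and \<alpha> \<beta> :: 'k
  assumes linear_p: "Vector_Spaces.linear scale scale p"
    and linear_q: "Vector_Spaces.linear scale scale q"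
    and pp: "p (p x) = p x" and qq: "q (q x) = q x"
    and u_eq: "u x = \<alpha> *s p x + \<beta> *s q x"
    and nz: "\<alpha> \<noteq> 0" "\<beta> \<noteq> 0" "\<alpha> \<noteq> \<beta>" "\<alpha> \<noteq> - \<beta>"
begin

sublocale p: Vector_Spaces.linear scale scale p by (rule linear_p)
sublocale q: Vector_Spaces.linear scale scale q by (rule linear_q)

lemmas pq_simps = p.add q.add p.scale q.scale p.diff q.diff p.neg q.neg pp qq

text \<open>
  This is \<open>(p - q)\<^sup>2\<close>, multiplied out.
\<close>
definition diff_square :: "'e \<Rightarrow> 'e" where "diff_square x = p x + q x - p (q x) - q (p x)"
definition commutator :: "'e \<Rightarrow> 'e" where "commutator x = p (q x) - q (p x)"

text \<open>
  The two products of exceptional linear factors; they act as multiples of \<open>(p - q)\<^sup>2\<close> and of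
  \<open>1 - (p - q)\<^sup>2\<close>.
\<close>
abbreviation D :: "'k poly" where "D \<equiv> [:- (\<alpha> + \<beta>), 1:] * [:- 0, 1:]"
abbreviation D' :: "'k poly" where "D' \<equiv> [:- \<alpha>, 1:] * [:- \<beta>, 1:]"

lemma D'_eq: "D' = D + [:\<alpha> * \<beta>:]" by simp

lemma act_D: "D \<cdot> x = - (\<alpha> * \<beta>) *s diff_square x"
proof -
  have "D \<cdot> x = u (u x) - (\<alpha> + \<beta>) *s u x"
    by (simp only: act_mult act_linear_factor scale_zero_left diff_zero)
  also have "\<dots> = - (\<alpha> * \<beta>) *s diff_square x"
    by (simp add: u_eq diff_square_def pq_simps algebra_simps)
  finally show ?thesis .
qed

lemma act_D': "D' \<cdot> x = (\<alpha> * \<beta>) *s (x - diff_square x)"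
proof -
  have "D' \<cdot> x = D \<cdot> x + (\<alpha> * \<beta>) *s x" unfolding D'_eq act_add by (simp add: act_pCons)
  then show ?thesis unfolding act_D by (simp add: algebra_simps)
qed

lemma linear_commutator: "Vector_Spaces.linear scale scale commutator"
  by unfold_locales (simp_all add: commutator_def pq_simps algebra_simps)

lemma commutator_u: "commutator (u x) = (\<alpha> + \<beta>) *s commutator x - u (commutator x)"
  by (simp add: commutator_def u_eq pq_simps algebra_simps)

text \<open>
  As \<open>g u = (\<alpha> + \<beta> - u) g\<close> for the commutator \<open>g\<close>, it exchanges the roles of \<open>c\<close> and \<open>\<alpha> + \<beta> - c\<close>.
\<close>
lemma commutator_factor:
  assumes "c + d = \<alpha> + \<beta>" shows "commutator ([:- c, 1:] \<cdot> x) = - ([:- d, 1:] \<cdot> commutator x)"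
proof -
  interpret commutator: Vector_Spaces.linear scale scale commutator by (rule linear_commutator)
  have "commutator ([:- c, 1:] \<cdot> x) = (\<alpha> + \<beta>) *s commutator x - u (commutator x) - c *s commutator x"
    by (simp only: act_linear_factor commutator.diff commutator.scale commutator_u)
  also have "\<dots> = - ([:- d, 1:] \<cdot> commutator x)"
    unfolding assms[symmetric] act_linear_factor by (simp add: algebra_simps)
  finally show ?thesis .
qed

text \<open>
  For the commutator \<open>g\<close> this is the identity \<open>g\<^sup>2 = - (p - q)\<^sup>2 (1 - (p - q)\<^sup>2)\<close>, expressed through \<open>u\<close>.
\<close>
lemma commutator_square: "commutator (commutator x) = smult (inverse ((\<alpha> * \<beta>)\<^sup>2)) (D * D') \<cdot> x"
proof -
  have "(D * D') \<cdot> x = - (\<alpha> * \<beta>)\<^sup>2 *s diff_square (x - diff_square x)"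
    unfolding act_mult[of D D'] act_D' act_D
    by (simp add: diff_square_def pq_simps algebra_simps power2_eq_square)
  also have "diff_square (x - diff_square x) = - commutator (commutator x)"
    by (simp add: diff_square_def commutator_def pq_simps algebra_simps)
  finally have "(D * D') \<cdot> x = (\<alpha> * \<beta>)\<^sup>2 *s commutator (commutator x)" by simp
  then show ?thesis using nz unfolding act_smult by simp
qed

text \<open>
  For each exceptional \<open>c\<close> the polynomial \<open>D D'\<close> has \<open>X - c\<close> as a simple factor, the four scalars being
  distinct.
\<close>
lemma kernel_jumps_intertwined:
  shows "intertwined (kernel_jump scale u 0) (kernel_jump scale u (\<alpha> + \<beta>))"
    and "intertwined (kernel_jump scale u \<alpha>) (kernel_jump scale u \<beta>)"
proof -
  let ?i = "inverse ((\<alpha> * \<beta>)\<^sup>2)"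
  have i: "?i \<noteq> 0" using nz by simp
  have s0: "\<alpha> + \<beta> \<noteq> 0" "- \<alpha> \<noteq> \<beta>" using nz by (auto simp: eq_neg_iff_add_eq_0)
  have le: "kernel_jump scale u c (k + 1) \<le> kernel_jump scale u d k"
    if "c + d = \<alpha> + \<beta>" "D * D' = [:- c, 1:] * r" "poly r c \<noteq> 0" "1 \<le> k" for c d r k
  proof (rule kernel_jump_le[OF linear_commutator commutator_factor commutator_factor])
    show "commutator (commutator x) = ([:- c, 1:] * smult ?i r) \<cdot> x" for x
      unfolding commutator_square that(2) mult_smult_right ..
    show "poly (smult ?i r) c \<noteq> 0" using that(3) i by simp
  qed (use that in \<open>simp_all add: add.commute\<close>)
  have "kernel_jump scale u 0 (k + 1) \<le> kernel_jump scale u (\<alpha> + \<beta>) k" if "1 \<le> k" for k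
  proof (rule le[OF _ _ _ that])
    show "D * D' = [:- 0, 1:] * ([:- (\<alpha> + \<beta>), 1:] * D')" by (simp only: ac_simps)
  qed (use nz s0 in \<open>simp_all add: poly_mult del: mult_pCons_left mult_pCons_right\<close>)
  moreover have "kernel_jump scale u (\<alpha> + \<beta>) (k + 1) \<le> kernel_jump scale u 0 k" if "1 \<le> k" for k
  proof (rule le[OF _ _ _ that])
    show "D * D' = [:- (\<alpha> + \<beta>), 1:] * ([:- 0, 1:] * D')" by (simp only: ac_simps)
  qed (use nz s0 in \<open>simp_all add: poly_mult del: mult_pCons_left mult_pCons_right\<close>)
  ultimately show "intertwined (kernel_jump scale u 0) (kernel_jump scale u (\<alpha> + \<beta>))"
    unfolding intertwined_def by blast
  have "kernel_jump scale u \<alpha> (k + 1) \<le> kernel_jump scale u \<beta> k" if "1 \<le> k" for k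
  proof (rule le[OF _ _ _ that])
    show "D * D' = [:- \<alpha>, 1:] * (D * [:- \<beta>, 1:])" by (simp only: ac_simps)
  qed (use nz s0 in \<open>simp_all add: poly_mult del: mult_pCons_left mult_pCons_right\<close>)
  moreover have "kernel_jump scale u \<beta> (k + 1) \<le> kernel_jump scale u \<alpha> k" if "1 \<le> k" for k
  proof (rule le[OF _ _ _ that])
    show "D * D' = [:- \<beta>, 1:] * (D * [:- \<alpha>, 1:])" by (simp only: ac_simps)
  qed (use nz s0 in \<open>simp_all add: poly_mult del: mult_pCons_left mult_pCons_right\<close>)
  ultimately show "intertwined (kernel_jump scale u \<alpha>) (kernel_jump scale u \<beta>)"
    unfolding intertwined_def by blast
qed

lemma commute_diff_square: "p (diff_square x) = diff_square (p x)" "q (diff_square x) = diff_square (q x)"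
  by (simp_all add: diff_square_def pq_simps algebra_simps)

lemma commute_D: "p (D \<cdot> x) = D \<cdot> p x" "q (D \<cdot> x) = D \<cdot> q x"
  unfolding act_D by (simp_all only: p.scale q.scale commute_diff_square)

lemma commute_D': "p (D' \<cdot> x) = D' \<cdot> p x" "q (D' \<cdot> x) = D' \<cdot> q x"
  unfolding act_D' by (simp_all only: p.scale q.scale p.diff q.diff commute_diff_square)

lemma commute_power: "p ((D * D') ^ N \<cdot> x) = (D * D') ^ N \<cdot> p x" "q ((D * D') ^ N \<cdot> x) = (D * D') ^ N \<cdot> q x"
proof -
  have p: "p ((D * D') \<cdot> y) = (D * D') \<cdot> p y" and q: "q ((D * D') \<cdot> y) = (D * D') \<cdot> q y" for y
    by (simp_all only: act_mult[of D D'] commute_D commute_D')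
  show "p ((D * D') ^ N \<cdot> x) = (D * D') ^ N \<cdot> p x"
    by (induction N) (simp_all only: power_0 power_Suc act_mult[of "D * D'"] act_1 p)
  show "q ((D * D') ^ N \<cdot> x) = (D * D') ^ N \<cdot> q x"
    by (induction N) (simp_all only: power_0 power_Suc act_mult[of "D * D'"] act_1 q)
qed

text \<open>
  On \<open>F\<close> the map \<open>q\<close> is injective, because \<open>p x = x\<close> and \<open>q x = 0\<close> give \<open>(p - q)\<^sup>2 x = x\<close>, and \<open>F\<close> meets \<open>q F\<close>
  only in \<open>0\<close>, because \<open>p y = q y = y\<close> gives \<open>(p - q)\<^sup>2 y = 0\<close>; so \<open>2 dim F \<le> dim E\<close>. The same holds for the
  kernel \<open>G\<close> of \<open>p\<close> in \<open>E\<close>, with the two arguments exchanged. As \<open>E = F \<oplus> G\<close>, both are equalities.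
\<close>
lemma fixed_space_doubling:
  assumes E: "subspace E" and Ep: "\<And>x. x \<in> E \<Longrightarrow> p x \<in> E" and Eq: "\<And>x. x \<in> E \<Longrightarrow> q x \<in> E"
    and e0: "\<And>x. x \<in> E \<Longrightarrow> diff_square x = 0 \<Longrightarrow> x = 0" and e1: "\<And>x. x \<in> E \<Longrightarrow> diff_square x = x \<Longrightarrow> x = 0"
  defines "F \<equiv> {x \<in> E. p x = x}"
  shows "subspace F" "dim E = 2 * dim F" "span (F \<union> q ` F) = E"
proof -
  define G where "G = {x \<in> E. p x = 0}"
  show sF: "subspace F"
    unfolding F_def by (rule subspaceI) (use E in \<open>simp_all add: subspace_0 subspace_add subspace_scale p.zero p.add p.scale\<close>)
  have sG: "subspace G"
    unfolding G_def by (rule subspaceI) (use E in \<open>simp_all add: subspace_0 subspace_add subspace_scale p.zero p.add p.scale\<close>)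
  have FE: "F \<subseteq> E" and GE: "G \<subseteq> E" by (auto simp: F_def G_def)
  have sum: "dim E = dim F + dim G"
  proof -
    have "span (F \<union> G) = E"
    proof
      show "span (F \<union> G) \<subseteq> E" using FE GE E by (intro span_minimal) auto
      show "E \<subseteq> span (F \<union> G)"
      proof
        fix x assume x: "x \<in> E"
        have "p x \<in> F" "x - p x \<in> G"
          using x Ep E by (auto simp: F_def G_def pp p.diff subspace_diff)
        then have "p x + (x - p x) \<in> span (F \<union> G)" by (metis UnI1 UnI2 span_add span_base)
        then show "x \<in> span (F \<union> G)" by simp
      qed
    qed
    moreover have "F \<inter> G \<subseteq> {0}" by (auto simp: F_def G_def)
    ultimately show ?thesis using dim_direct_sum[OF sF sG] by simp
  qed
  have qF: "q ` F \<subseteq> E" and qG: "q ` G \<subseteq> E" using FE GE Eq by auto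
  have dqF: "dim (q ` F) = dim F"
  proof (rule dim_linear_image_inj[OF linear_q sF])
    fix x assume "x \<in> F" "q x = 0"
    then show "x = 0" using e1[of x] by (simp add: F_def diff_square_def p.zero)
  qed
  have dqG: "dim (q ` G) = dim G"
  proof (rule dim_linear_image_inj[OF linear_q sG])
    fix x assume "x \<in> G" "q x = 0"
    then show "x = 0" using e0[of x] by (simp add: G_def diff_square_def p.zero q.zero)
  qed
  have "F \<inter> q ` F \<subseteq> {0}"
  proof
    fix y assume "y \<in> F \<inter> q ` F"
    then have "y \<in> E" "p y = y" "q y = y" by (auto simp: F_def qq)
    then show "y \<in> {0}" using e0[of y] by (simp add: diff_square_def)
  qed
  then have dF: "dim (span (F \<union> q ` F)) = 2 * dim F"
    using dim_direct_sum[OF sF q.subspace_image[OF sF]] dqF by simp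
  have "G \<inter> q ` G \<subseteq> {0}"
  proof
    fix y assume "y \<in> G \<inter> q ` G"
    then have "y \<in> E" "p y = 0" "q y = y" by (auto simp: G_def qq)
    then show "y \<in> {0}" using e1[of y] by (simp add: diff_square_def q.zero)
  qed
  then have dG: "dim (span (G \<union> q ` G)) = 2 * dim G"
    using dim_direct_sum[OF sG q.subspace_image[OF sG]] dqG by simp
  have subF: "span (F \<union> q ` F) \<subseteq> E" and subG: "span (G \<union> q ` G) \<subseteq> E"
    by (rule span_minimal; use FE GE qF qG E in blast)+
  have "2 * dim F \<le> dim E" "2 * dim G \<le> dim E"
    using dim_subset[OF subF] dim_subset[OF subG] dF dG by simp_all
  then show eq: "dim E = 2 * dim F" using sum by simp
  show "span (F \<union> q ` F) = E"
    by (rule subspace_dim_equal) (use subF E dF eq in auto)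
qed

text \<open>
  The reduced space \<open>E\<close> is also the range of \<open>(D D')\<^sup>N\<close>, which commutes with \<open>p\<close> and \<open>q\<close>; so \<open>E\<close> is stable
  under both. Since \<open>E = F + q F = F + u F\<close>, a cyclic decomposition of \<open>D(u)\<close> on \<open>F\<close> into vectors \<open>x\<close> with
  annihilators \<open>P\<close> yields one of \<open>u\<close> on \<open>E\<close>: the vectors \<open>D\<^sup>j x\<close> and \<open>X D\<^sup>j x\<close> with \<open>j < degree P\<close> generate \<open>E\<close>
  and lie in the Krylov space of \<open>x\<close> of length \<open>2 degree P\<close>, the degree of \<open>P(D)\<close>.
\<close>
lemma elementary_factors_exist:
  "\<exists>Ps. elementary_factors scale (reduced_space scale u {0, \<alpha>, \<beta>, \<alpha> + \<beta>}) u Ps \<and>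
     (\<forall>P\<in>set Ps. \<exists>S. P = pcompose S D)"
proof -
  obtain Q N where Q: "reduced_space scale u {0, \<alpha>, \<beta>, \<alpha> + \<beta>} = {x. Q \<cdot> x = 0}"
    and co: "\<And>c. c \<in> {0, \<alpha>, \<beta>, \<alpha> + \<beta>} \<Longrightarrow> comaximal [:- c, 1:] Q"
    and kill: "\<And>Z x. (\<And>c. c \<in> {0, \<alpha>, \<beta>, \<alpha> + \<beta>} \<Longrightarrow> [:- c, 1:] dvd Z) \<Longrightarrow> (Z ^ N * Q) \<cdot> x = 0"
    by (rule reduced_space_eq[of "{0, \<alpha>, \<beta>, \<alpha> + \<beta>}"]) (rule that; blast)
  define E where "E = {x. Q \<cdot> x = 0}"
  have stE: "stable E" unfolding E_def by (rule stable_kernel)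
  have sE: "subspace E" using stE stable_subspace by blast
  let ?Z = "D * D'"
  have coD: "comaximal D Q" and coD': "comaximal D' Q"
    by (rule comaximal_mult; rule co; simp)+
  have coZ: "comaximal (?Z ^ N) Q" by (intro comaximal_power comaximal_mult coD coD')
  obtain a b where ab: "a * ?Z ^ N + b * Q = 1" using coZ comaximal_def by blast
  have killZ: "(?Z ^ N * Q) \<cdot> x = 0" for x
    by (rule kill) (auto simp del: mult_pCons_left mult_pCons_right intro: dvd_mult dvd_mult2)
  have E_range: "E = range (\<lambda>x. ?Z ^ N \<cdot> x)"
  proof
    show "range (\<lambda>x. ?Z ^ N \<cdot> x) \<subseteq> E"
      using killZ unfolding E_def act_mult by (metis (mono_tags, lifting) act_commute image_subsetI mem_Collect_eq)
    show "E \<subseteq> range (\<lambda>x. ?Z ^ N \<cdot> x)"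
    proof
      fix x assume "x \<in> E"
      then have "x = (a * ?Z ^ N) \<cdot> x" using ab act_add[of "a * ?Z ^ N" "b * Q" x] by (simp add: E_def act_mult)
      then have "x = ?Z ^ N \<cdot> a \<cdot> x" by (metis act_mult act_commute)
      then show "x \<in> range (\<lambda>x. ?Z ^ N \<cdot> x)" by blast
    qed
  qed
  have Ep: "p x \<in> E" if "x \<in> E" for x using that unfolding E_range by (auto simp only: commute_power)
  have Eq: "q x \<in> E" if "x \<in> E" for x using that unfolding E_range by (auto simp only: commute_power)
  have e0: "x = 0" if "x \<in> E" "diff_square x = 0" for x
    by (rule act_comaximal_zero[OF coD]) (use that in \<open>simp_all only: act_D E_def mem_Collect_eq scale_zero_right\<close>)
  have e1: "x = 0" if "x \<in> E" "diff_square x = x" for x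
    by (rule act_comaximal_zero[OF coD']) (use that in \<open>simp_all only: act_D' E_def mem_Collect_eq diff_self scale_zero_right\<close>)
  define F where "F = {x \<in> E. p x = x}"
  have F: "subspace F" "dim E = 2 * dim F" "span (F \<union> q ` F) = E"
    using fixed_space_doubling[OF sE Ep Eq e0 e1] unfolding F_def by blast+
  interpret T: endomorphism scale Basis "poly_endo scale D u" by (rule endomorphism_act)
  have "T.stable F"
    unfolding T.stable_def
  proof (intro conjI F ballI)
    fix x assume "x \<in> F"
    then show "D \<cdot> x \<in> F" unfolding F_def using stable_act[OF stE] commute_D(1) by auto
  qed
  then obtain L where L: "\<And>x P. (x, P) \<in> set L \<Longrightarrow> x \<in> F \<and> lead_coeff P = 1 \<and> degree P > 0 \<and> poly_endo scale P (poly_endo scale D u) x = 0"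
    "sorted_wrt (dvd) (map snd L)" "F = span (\<Union>(x, P)\<in>set L. T.krylov x (degree P))"
    "(\<Sum>(x, P)\<leftarrow>L. degree P) = dim F" by (rule T.cyclic_decomposition) blast
  define L' where "L' = map (\<lambda>(x, P). (x, pcompose P D)) L"
  have dD: "degree D = 2" and lD: "lead_coeff D = 1" by simp_all
  have L': "x \<in> F \<and> lead_coeff P = 1 \<and> degree P > 0 \<and> P \<cdot> x = 0" if xP: "(x, P) \<in> set L'" for x P
  proof -
    obtain P' where P': "(x, P') \<in> set L" "P = pcompose P' D"
      using xP unfolding L'_def by (auto simp del: mult_pCons_left mult_pCons_right)
    then show ?thesis
      using L(1)[OF P'(1)] monic_pcompose[OF _ lD, of P'] dD act_pcompose[of P' D x] 
      by (simp add: degree_pcompose del: mult_pCons_left mult_pCons_right)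
  qed
  let ?S = "span (\<Union>(x, P)\<in>set L'. krylov x (degree P))"
  have krylovS: "krylov x (2 * degree P) \<subseteq> ?S" if "(x, P) \<in> set L" for x P
  proof -
    have "(x, pcompose P D) \<in> set L'" using that by (force simp: L'_def)
    moreover have "degree (pcompose P D) = 2 * degree P" unfolding degree_pcompose dD by simp
    ultimately have "krylov x (2 * degree P) \<subseteq> (\<Union>(x, P)\<in>set L'. krylov x (degree P))" by force
    then show ?thesis using span_superset by blast
  qed
  have FS: "F \<subseteq> {y. y \<in> ?S \<and> u y \<in> ?S}"
    unfolding L(3)
  proof (rule span_minimal)
    show "subspace {y. y \<in> ?S \<and> u y \<in> ?S}"
      by (rule subspaceI) (auto simp: u_add u_scale span_zero span_add span_scale)
    then have sub: "subspace {y. y \<in> ?S \<and> u y \<in> ?S}" .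
    show "(\<Union>(x, P)\<in>set L. T.krylov x (degree P)) \<subseteq> {y. y \<in> ?S \<and> u y \<in> ?S}"
    proof (clarify)
      fix y x P assume xP: "(x, P) \<in> set L" and y: "y \<in> T.krylov x (degree P)"
      have "T.krylov x (degree P) \<subseteq> {y. y \<in> ?S \<and> u y \<in> ?S}"
        unfolding T.krylov_def
      proof (rule span_minimal[OF _ sub], rule image_subsetI, rule CollectI, rule conjI)
        fix j assume "j \<in> {..<degree P}"
        then have j: "j < degree P" by simp
        have eq: "(poly_endo scale D u ^^ j) x = D ^ j \<cdot> x" by (simp only: act_power)
        have deg: "degree (D ^ j) = 2 * j" using dD by (subst degree_power_eq) auto
        have "coeff (D ^ j) i = 0" if "i \<ge> 2 * degree P" for i
          using that j deg by (intro coeff_eq_0) simp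
        then have "D ^ j \<cdot> x \<in> krylov x (2 * degree P)" unfolding krylov_iff by blast
        then show "(poly_endo scale D u ^^ j) x \<in> ?S" unfolding eq using krylovS[OF xP] by blast
        have "coeff (pCons 0 (D ^ j)) i = 0" if "i \<ge> 2 * degree P" for i
          using that j deg by (intro coeff_eq_0) (simp del: mult_pCons_left mult_pCons_right)
        moreover have "u (D ^ j \<cdot> x) = pCons 0 (D ^ j) \<cdot> x"
          unfolding act_pCons act_u by simp
        ultimately have "u (D ^ j \<cdot> x) \<in> krylov x (2 * degree P)" unfolding krylov_iff by metis
        then show "u ((poly_endo scale D u ^^ j) x) \<in> ?S" unfolding eq using krylovS[OF xP] by blast
      qed
      then show "y \<in> ?S \<and> u y \<in> ?S" using y by blast
    qed
  qed
  have span: "E = ?S"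
  proof
    have "q y \<in> ?S" if "y \<in> F" for y
    proof -
      have py: "p y = y" using that by (simp add: F_def)
      have "u y - \<alpha> *s y = \<beta> *s q y" unfolding u_eq py by simp
      moreover have "u y - \<alpha> *s y \<in> ?S" using FS that by (blast intro: span_diff span_scale)
      ultimately have "inverse \<beta> *s (\<beta> *s q y) \<in> ?S" using span_scale by metis
      then show ?thesis using nz by simp
    qed
    then have "span (F \<union> q ` F) \<subseteq> ?S" using FS by (intro span_minimal) auto
    then show "E \<subseteq> ?S" using F(3) by simp
    have "krylov x (degree P) \<subseteq> E" if "(x, P) \<in> set L'" for x P
    proof -
      have "x \<in> E" using L'[OF that] by (simp add: F_def)
      then show ?thesis using stable_act[OF stE] by (auto simp: krylov_iff)
    qed
    then show "?S \<subseteq> E" using sE by (intro span_minimal) auto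
  qed
  have snd: "map snd L' = map (\<lambda>P. pcompose P D) (map snd L)" by (simp add: L'_def case_prod_beta)
  have "elementary_factors scale E u (map snd L')"
    unfolding elementary_factors_iff[OF sE]
  proof (intro conjI)
    show "\<forall>P\<in>set (map snd L'). lead_coeff P = 1 \<and> degree P > 0" using L' by fastforce
    have dvd: "pcompose P D dvd pcompose P' D" if "P dvd P'" for P P'
      using that by (auto simp only: dvd_def pcompose_mult)
    show "sorted_wrt (dvd) (map snd L')"
      unfolding snd sorted_wrt_map[of _ "\<lambda>P. pcompose P D"]
      by (rule sorted_wrt_mono_rel[OF dvd L(2)])
    have sum: "sum_list (map degree (map snd L')) = dim E"
    proof -
      have "sum_list (map degree (map snd L')) = (\<Sum>(x, P)\<leftarrow>L. 2 * degree P)"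
        unfolding snd map_map comp_def degree_pcompose dD case_prod_unfold by (simp add: mult.commute)
      also have "\<dots> = 2 * (\<Sum>(x, P)\<leftarrow>L. degree P)"
        by (simp add: sum_list_const_mult case_prod_unfold)
      finally show ?thesis using L(4) F(2) by simp
    qed
    show "\<exists>L. map snd L = map snd L' \<and> (\<forall>(x, P)\<in>set L. P \<cdot> x = 0) \<and>
        E = span (\<Union>(x, P)\<in>set L. krylov x (degree P)) \<and> sum_list (map degree (map snd L')) = dim E"
      using L' span sum by blast
  qed
  moreover have "\<forall>P\<in>set (map snd L'). \<exists>S. P = pcompose S D" unfolding snd by auto
  ultimately show ?thesis unfolding Q E_def by blast
qed

end

theorem theorem8:
  fixes scale :: "'k::field \<Rightarrow> 'e::ab_group_add \<Rightarrow> 'e" and Basis :: "'e set"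
    and u :: "'e \<Rightarrow> 'e" and \<alpha> \<beta> :: 'k and n :: nat
  assumes "finite_dimensional_vector_space scale Basis"
    and "vector_space.dim scale (UNIV :: 'e set) = n" and "n \<ge> 1"
    and "Vector_Spaces.linear scale scale u"
    and "\<alpha> \<noteq> 0" and "\<beta> \<noteq> 0" and "\<alpha> \<noteq> \<beta>" and "\<alpha> \<noteq> - \<beta>"
  shows "composite scale \<alpha> \<beta> u \<longleftrightarrow>
    intertwined (kernel_jump scale u 0) (kernel_jump scale u (\<alpha> + \<beta>)) \<and>
    intertwined (kernel_jump scale u \<alpha>) (kernel_jump scale u \<beta>) \<and>
    (\<exists>Ps. elementary_factors scale
            (reduced_space scale u {0, \<alpha>, \<beta>, \<alpha> + \<beta>}) u Ps \<and>
          (\<forall>P\<in>set Ps. polynomial_of ([:- \<alpha>, 1:] * [:- \<beta>, 1:]) P))"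
proof -
  interpret finite_dimensional_vector_space scale Basis by (rule assms(1))
  interpret endomorphism scale Basis u
    by (rule endomorphism.intro[OF assms(1) endomorphism_axioms.intro[OF assms(4)]])
  let ?D = "[:- (\<alpha> + \<beta>), 1:] * [:- 0, 1:]"
  have eq: "[:- \<alpha>, 1:] * [:- \<beta>, 1:] = ?D + [:\<alpha> * \<beta>:]" by simp
  have poly: "polynomial_of ([:- \<alpha>, 1:] * [:- \<beta>, 1:]) P \<longleftrightarrow> (\<exists>S. P = pcompose S ?D)" for P
    unfolding eq polynomial_of_shift unfolding polynomial_of_def ..
  show ?thesis
    unfolding poly
  proof (intro iffI conjI)
    assume "composite scale \<alpha> \<beta> u"
    then obtain p q where pq: "Vector_Spaces.linear scale scale p" "Vector_Spaces.linear scale scale q"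
      "p \<circ> p = p" "q \<circ> q = q" "u = (\<lambda>v. scale \<alpha> (p v) + scale \<beta> (q v))"
      unfolding composite_def by blast
    interpret idempotent_combination scale Basis u p q \<alpha> \<beta>
    proof (intro idempotent_combination.intro idempotent_combination_axioms.intro endomorphism_axioms pq(1,2) assms(5-8))
      show "p (p x) = p x" "q (q x) = q x" for x using pq(3,4) by (metis comp_apply)+
      show "u x = scale \<alpha> (p x) + scale \<beta> (q x)" for x using pq(5) by simp
    qed
    show "intertwined (kernel_jump scale u 0) (kernel_jump scale u (\<alpha> + \<beta>))"
      "intertwined (kernel_jump scale u \<alpha>) (kernel_jump scale u \<beta>)"
      by (rule kernel_jumps_intertwined)+
    show "\<exists>Ps. elementary_factors scale (reduced_space scale u {0, \<alpha>, \<beta>, \<alpha> + \<beta>}) u Ps \<and>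
        (\<forall>P\<in>set Ps. \<exists>S. P = pcompose S ?D)" by (rule elementary_factors_exist)
  next
    assume "intertwined (kernel_jump scale u 0) (kernel_jump scale u (\<alpha> + \<beta>)) \<and>
      intertwined (kernel_jump scale u \<alpha>) (kernel_jump scale u \<beta>) \<and>
      (\<exists>Ps. elementary_factors scale (reduced_space scale u {0, \<alpha>, \<beta>, \<alpha> + \<beta>}) u Ps \<and>
        (\<forall>P\<in>set Ps. \<exists>S. P = pcompose S ?D))"
    then show "composite scale \<alpha> \<beta> u" using composite_if_conditions[OF assms(5-8)] by blast
  qed
qed

end
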